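(* Let $\mathcal O\subset\mathfrak{sl}(2,\mathbb C)$ be the orbit of non-zero nilpotent elements. Then $\mathcal O$ has a one-parameter family of hyperKähler metrics with $SU(2)$-invariant Kähler potential (for the complex structure $I$) and compatible with the Kostant-Kirillov-Souriau complex symplectic form $\omega_c$.
   Context: Let $\langle\cdot,\cdot\rangle$ be the negative of the (complex bilinear) Killing form of $\mathfrak g^{\mathbb C}=\mathfrak{sl}(2,\mathbb C)$, $\mathfrak g=\mathfrak{su}(2)$, $G=SU(2)$. At $X\in\mathcal O$ the tangent vectors are $\xi_A=[A,X]$, $A\in\mathfrak g^{\mathbb C}$. The orbit $\mathcal O$ is a complex submanifold of $\mathfrak g^{\mathbb C}$, with complex structure $I\xi_A=i\xi_A=\xi_{iA}$. The Kostant-Kirillov-Souriau complex symplectic form on $\mathcal O$ is $\omega_c(\xi_A,\xi_B)_X=\langle X,[A,B]\rangle$. A hyperKähler metric on a manifold is a Riemannian metric $g$ together with complex structures $I,J,K$ satisfying $IJ=K=-JI$, such that $g$ is Kähler with respect to each of them; the Kähler forms are $\omega_I(Y,Z)=g(Y,IZ)$, $\omega_J(Y,Z)=g(Y,JZ)$, $\omega_K(Y,Z)=g(Y,KZ)$ for tangent vectors $Y,Z$. Here $I$ is always the natural complex structure on $\mathcal O$ given by $I\xi_A=i\xi_A=\xi_{iA}$ for $A\in\mathfrak g^{\mathbb C}$. The metric is compatible with $\omega_c$ if $\omega_c=\omega_J+i\omega_K$. A smooth function $\rho\colon\mathcal O\to\mathbb R$ is a Kähler potential for $I$ if $\omega_I=-i\,\partial_I\overline{\partial_I}\rho=-\tfrac12\,d\,I\,d\rho$,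 where for a one-form $\theta$ one puts $(I\theta)(Y)=-\theta(IY)$. *)

theory Defs
  imports "HOL-Analysis.Analysis"
begin

primrec higher_differentiable_on ::
  "nat \<Rightarrow> 'a set \<Rightarrow> ('a::real_normed_vector \<Rightarrow> 'b::real_normed_vector) \<Rightarrow> bool" where
  "higher_differentiable_on 0 S f \<longleftrightarrow> continuous_on S f"
| "higher_differentiable_on (Suc n) S f \<longleftrightarrow>
     (\<forall>x\<in>S. f differentiable (at x)) \<and>
     (\<forall>v. higher_differentiable_on n S (\<lambda>x. frechet_derivative f (at x) v))"

text \<open>For an embedded submanifold \<open>M\<close> this is smoothness in the sense of manifolds: near every
  point of \<open>M\<close> the function is the restriction of a smooth function on an open subset of the
  ambient space.\<close>

definition smooth_map_on ::
  "'a set \<Rightarrow> ('a::real_normed_vector \<Rightarrow> 'b::real_normed_vector) \<Rightarrow> bool" where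
  "smooth_map_on M f \<longleftrightarrow>
     (\<forall>x\<in>M. \<exists>W F. open W \<and> x \<in> W \<and> (\<forall>n. higher_differentiable_on n W F) \<and>
        (\<forall>y\<in>M \<inter> W. F y = f y))"


type_synonym mat2 = "complex^2^2"

definition sl2 :: "mat2 set" where
  "sl2 = {A. trace A = 0}"

definition bracket :: "mat2 \<Rightarrow> mat2 \<Rightarrow> mat2" where
  "bracket A B = A ** B - B ** A"

text \<open>The complex trace of an endomorphism \<open>L\<close> of \<open>sl2\<close>, computed in the basis
  \<open>H = diag(1,-1)\<close>, \<open>E = E\<^sub>1\<^sub>2\<close>, \<open>F = E\<^sub>2\<^sub>1\<close>, whose dual coordinates are the matrix entries
  \<open>(1,1)\<close>, \<open>(1,2)\<close>, \<open>(2,1)\<close>.\<close>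

definition sl2_endo_trace :: "(mat2 \<Rightarrow> mat2) \<Rightarrow> complex" where
  "sl2_endo_trace L =
     L (vector [vector [1, 0], vector [0, -1]]) $ 1 $ 1
   + L (vector [vector [0, 1], vector [0, 0]]) $ 1 $ 2
   + L (vector [vector [0, 0], vector [1, 0]]) $ 2 $ 1"

definition killing_form :: "mat2 \<Rightarrow> mat2 \<Rightarrow> complex" where
  "killing_form A B = sl2_endo_trace (\<lambda>C. bracket A (bracket B C))"

definition inner_sl2 :: "mat2 \<Rightarrow> mat2 \<Rightarrow> complex" where
  "inner_sl2 A B = - killing_form A B"

definition nilpotent_matrix :: "mat2 \<Rightarrow> bool" where
  "nilpotent_matrix X \<longleftrightarrow> (\<exists>k. (((**) X) ^^ k) (mat 1) = 0)"

definition nil_orbit :: "mat2 set" where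
  "nil_orbit = {X \<in> sl2. X \<noteq> 0 \<and> nilpotent_matrix X}"

definition \<xi> :: "mat2 \<Rightarrow> mat2 \<Rightarrow> mat2" where
  "\<xi> A X = bracket A X"

definition tangent :: "mat2 \<Rightarrow> mat2 set" where
  "tangent X = {\<xi> A X | A. A \<in> sl2}"

definition SU2 :: "mat2 set" where
  "SU2 = {U. map_matrix cnj (transpose U) ** U = mat 1 \<and> det U = 1}"

definition SU2_invariant :: "(mat2 \<Rightarrow> real) \<Rightarrow> bool" where
  "SU2_invariant \<rho> \<longleftrightarrow>
     (\<forall>U\<in>SU2. \<forall>X\<in>nil_orbit. \<rho> (U ** X ** matrix_inv U) = \<rho> X)"


text \<open>Tensor fields on the orbit are functions on the ambient space of which only the values at
  points of the orbit and on tangent vectors matter.\<close>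

definition vector_field :: "(mat2 \<Rightarrow> mat2) \<Rightarrow> bool" where
  "vector_field V \<longleftrightarrow> smooth_map_on nil_orbit V \<and> (\<forall>X\<in>nil_orbit. V X \<in> tangent X)"

text \<open>The derivative within the orbit is determined only on tangent vectors; the argument \<open>Y\<close>
  below is always tangent to the orbit at \<open>X\<close>. For real-valued \<open>f\<close> this is \<open>df(Y)\<close>.\<close>

definition dir_deriv :: "(mat2 \<Rightarrow> 'b::real_normed_vector) \<Rightarrow> mat2 \<Rightarrow> mat2 \<Rightarrow> 'b" where
  "dir_deriv f X Y = frechet_derivative f (at X within nil_orbit) Y"

definition lie_bracket :: "(mat2 \<Rightarrow> mat2) \<Rightarrow> (mat2 \<Rightarrow> mat2) \<Rightarrow> mat2 \<Rightarrow> mat2" where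
  "lie_bracket U V X = dir_deriv V X (U X) - dir_deriv U X (V X)"

text \<open>Exterior derivatives of one-forms and two-forms, evaluated on vector fields (without
  combinatorial factors).\<close>

definition ext_deriv1 ::
  "(mat2 \<Rightarrow> mat2 \<Rightarrow> real) \<Rightarrow> (mat2 \<Rightarrow> mat2) \<Rightarrow> (mat2 \<Rightarrow> mat2) \<Rightarrow> mat2 \<Rightarrow> real" where
  "ext_deriv1 \<theta> U V X =
     dir_deriv (\<lambda>P. \<theta> P (V P)) X (U X) - dir_deriv (\<lambda>P. \<theta> P (U P)) X (V X)
     - \<theta> X (lie_bracket U V X)"

definition ext_deriv2 ::
  "(mat2 \<Rightarrow> mat2 \<Rightarrow> mat2 \<Rightarrow> real) \<Rightarrow> (mat2 \<Rightarrow> mat2) \<Rightarrow> (mat2 \<Rightarrow> mat2) \<Rightarrow> (mat2 \<Rightarrow> mat2)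
     \<Rightarrow> mat2 \<Rightarrow> real" where
  "ext_deriv2 \<omega> U V W X =
     dir_deriv (\<lambda>P. \<omega> P (V P) (W P)) X (U X)
   - dir_deriv (\<lambda>P. \<omega> P (U P) (W P)) X (V X)
   + dir_deriv (\<lambda>P. \<omega> P (U P) (V P)) X (W X)
   - \<omega> X (lie_bracket U V X) (W X)
   + \<omega> X (lie_bracket U W X) (V X)
   - \<omega> X (lie_bracket V W X) (U X)"

definition closed_two_form :: "(mat2 \<Rightarrow> mat2 \<Rightarrow> mat2 \<Rightarrow> real) \<Rightarrow> bool" where
  "closed_two_form \<omega> \<longleftrightarrow>
     (\<forall>U V W. vector_field U \<longrightarrow> vector_field V \<longrightarrow> vector_field W \<longrightarrow>
        (\<forall>X\<in>nil_orbit. ext_deriv2 \<omega> U V W X = 0))"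


definition riemannian_metric :: "(mat2 \<Rightarrow> mat2 \<Rightarrow> mat2 \<Rightarrow> real) \<Rightarrow> bool" where
  "riemannian_metric g \<longleftrightarrow>
     (\<forall>X\<in>nil_orbit.
        (\<forall>Y\<in>tangent X. \<forall>Z\<in>tangent X. g X Y Z = g X Z Y) \<and>
        (\<forall>Y\<in>tangent X. \<forall>Y'\<in>tangent X. \<forall>Z\<in>tangent X. \<forall>a b.
           g X (a *\<^sub>R Y + b *\<^sub>R Y') Z = a * g X Y Z + b * g X Y' Z) \<and>
        (\<forall>Y\<in>tangent X. Y \<noteq> 0 \<longrightarrow> g X Y Y > 0)) \<and>
     (\<forall>U V. vector_field U \<longrightarrow> vector_field V \<longrightarrow>
        smooth_map_on nil_orbit (\<lambda>X. g X (U X) (V X)))"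

definition nijenhuis ::
  "(mat2 \<Rightarrow> mat2 \<Rightarrow> mat2) \<Rightarrow> (mat2 \<Rightarrow> mat2) \<Rightarrow> (mat2 \<Rightarrow> mat2) \<Rightarrow> mat2 \<Rightarrow> mat2" where
  "nijenhuis J U V X =
     lie_bracket (\<lambda>P. J P (U P)) (\<lambda>P. J P (V P)) X
   - J X (lie_bracket (\<lambda>P. J P (U P)) V X)
   - J X (lie_bracket U (\<lambda>P. J P (V P)) X)
   - lie_bracket U V X"

text \<open>A complex structure is an integrable almost complex structure.\<close>

definition complex_structure :: "(mat2 \<Rightarrow> mat2 \<Rightarrow> mat2) \<Rightarrow> bool" where
  "complex_structure J \<longleftrightarrow>
     (\<forall>X\<in>nil_orbit.
        (\<forall>Y\<in>tangent X. J X Y \<in> tangent X \<and> J X (J X Y) = - Y) \<and>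
        (\<forall>Y\<in>tangent X. \<forall>Z\<in>tangent X. \<forall>a b.
           J X (a *\<^sub>R Y + b *\<^sub>R Z) = a *\<^sub>R J X Y + b *\<^sub>R J X Z)) \<and>
     (\<forall>U. vector_field U \<longrightarrow> vector_field (\<lambda>X. J X (U X))) \<and>
     (\<forall>U V. vector_field U \<longrightarrow> vector_field V \<longrightarrow> (\<forall>X\<in>nil_orbit. nijenhuis J U V X = 0))"

definition kahler_form ::
  "(mat2 \<Rightarrow> mat2 \<Rightarrow> mat2 \<Rightarrow> real) \<Rightarrow> (mat2 \<Rightarrow> mat2 \<Rightarrow> mat2) \<Rightarrow> mat2 \<Rightarrow> mat2 \<Rightarrow> mat2 \<Rightarrow> real" where
  "kahler_form g J X Y Z = g X Y (J X Z)"

definition kahler ::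
  "(mat2 \<Rightarrow> mat2 \<Rightarrow> mat2 \<Rightarrow> real) \<Rightarrow> (mat2 \<Rightarrow> mat2 \<Rightarrow> mat2) \<Rightarrow> bool" where
  "kahler g J \<longleftrightarrow>
     riemannian_metric g \<and> complex_structure J \<and>
     (\<forall>X\<in>nil_orbit. \<forall>Y\<in>tangent X. \<forall>Z\<in>tangent X. g X (J X Y) (J X Z) = g X Y Z) \<and>
     closed_two_form (kahler_form g J)"

definition I_nat :: "mat2 \<Rightarrow> mat2 \<Rightarrow> mat2" where
  "I_nat X Y = mat \<i> ** Y"

definition hyperkahler ::
  "(mat2 \<Rightarrow> mat2 \<Rightarrow> mat2 \<Rightarrow> real) \<Rightarrow> (mat2 \<Rightarrow> mat2 \<Rightarrow> mat2) \<Rightarrow> (mat2 \<Rightarrow> mat2 \<Rightarrow> mat2)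
     \<Rightarrow> (mat2 \<Rightarrow> mat2 \<Rightarrow> mat2) \<Rightarrow> bool" where
  "hyperkahler g I J K \<longleftrightarrow>
     kahler g I \<and> kahler g J \<and> kahler g K \<and>
     (\<forall>X\<in>nil_orbit. \<forall>Y\<in>tangent X. I X (J X Y) = K X Y \<and> J X (I X Y) = - K X Y)"

text \<open>Compatibility with the Kostant-Kirillov-Souriau form \<open>\<omega>\<^sub>c(\<xi>\<^sub>A, \<xi>\<^sub>B)\<^sub>X = \<langle>X, [A,B]\<rangle>\<close>.\<close>

definition KKS_compatible ::
  "(mat2 \<Rightarrow> mat2 \<Rightarrow> mat2 \<Rightarrow> real) \<Rightarrow> (mat2 \<Rightarrow> mat2 \<Rightarrow> mat2) \<Rightarrow> (mat2 \<Rightarrow> mat2 \<Rightarrow> mat2) \<Rightarrow> bool" where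
  "KKS_compatible g J K \<longleftrightarrow>
     (\<forall>X\<in>nil_orbit. \<forall>A\<in>sl2. \<forall>B\<in>sl2.
        inner_sl2 X (bracket A B) =
          complex_of_real (kahler_form g J X (\<xi> A X) (\<xi> B X))
          + \<i> * complex_of_real (kahler_form g K X (\<xi> A X) (\<xi> B X)))"

definition act_one_form ::
  "(mat2 \<Rightarrow> mat2 \<Rightarrow> mat2) \<Rightarrow> (mat2 \<Rightarrow> mat2 \<Rightarrow> real) \<Rightarrow> mat2 \<Rightarrow> mat2 \<Rightarrow> real" where
  "act_one_form I \<theta> X Y = - \<theta> X (I X Y)"

text \<open>\<open>\<omega>\<^sub>I = - 1/2 d I d\<rho>\<close>\<close>

definition kahler_potential ::
  "(mat2 \<Rightarrow> mat2 \<Rightarrow> mat2 \<Rightarrow> real) \<Rightarrow> (mat2 \<Rightarrow> mat2 \<Rightarrow> mat2) \<Rightarrow> (mat2 \<Rightarrow> real) \<Rightarrow> bool" where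
  "kahler_potential g I \<rho> \<longleftrightarrow>
     smooth_map_on nil_orbit \<rho> \<and>
     (\<forall>U V. vector_field U \<longrightarrow> vector_field V \<longrightarrow>
        (\<forall>X\<in>nil_orbit. kahler_form g I X (U X) (V X) =
           - (1/2) * ext_deriv1 (act_one_form I (dir_deriv \<rho>)) U V X))"


text \<open>A family parametrized by a nondegenerate real interval (of any kind), depending smoothly on
  the parameter and the point jointly, and whose members are pairwise distinct.\<close>

definition one_parameter_family ::
  "real set \<Rightarrow> (real \<Rightarrow> mat2 \<Rightarrow> mat2 \<Rightarrow> mat2 \<Rightarrow> real) \<Rightarrow> bool" where
  "one_parameter_family T g \<longleftrightarrow>
     is_interval T \<and> interior T \<noteq> {} \<and>
     (\<forall>U V. vector_field U \<longrightarrow> vector_field V \<longrightarrow>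
        smooth_map_on (T \<times> nil_orbit) (\<lambda>(c, X). g c X (U X) (V X))) \<and>
     (\<forall>c\<in>T. \<forall>c'\<in>T. c \<noteq> c' \<longrightarrow>
        (\<exists>X\<in>nil_orbit. \<exists>Y\<in>tangent X. \<exists>Z\<in>tangent X. g c X Y Z \<noteq> g c' X Y Z))"

end

theory Submission
  imports Defs
begin

text \<open>An \<open>SU(2)\<close>-invariant potential is a function \<open>f(s)\<close> of \<open>s = \<bar>X\<bar>\<^sup>2\<close>. The endomorphism \<open>J\<close>
  defined by \<open>g(Y, J Z) = Re \<omega>\<^sub>c(Y, Z)\<close> squares to \<open>-1\<close> iff \<open>w = s f'(s)\<close> satisfies an ordinary
  differential equation with solutions \<open>w\<^sup>2 = 4 s + c\<close>, and \<open>c \<ge> 0\<close> is needed on the whole orbit.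
  The form \<open>\<omega>\<^sub>I\<close> is closed because it comes from a potential, and \<open>\<omega>\<^sub>c\<close> is closed because it is a
  multiple of \<open>dx \<and> dy / y\<close> in matrix entries. Integrability of \<open>I\<close>, \<open>J\<close>, \<open>K\<close> follows from
  closedness of the three two-forms: the vectors of one type for one of the structures form the
  kernel of a closed complex two-form built from the forms of the other two.\<close>

subsection \<open>Smooth maps\<close>

text \<open>The orbit has complex dimension two, and \<open>X\<close> and \<open>D = [X, X*]\<close>
  form a frame of the tangent space that is orthogonal for the Hessian \<open>h\<close> of any
  \<open>f(s)\<close>. Hence \<open>J\<close> squares to \<open>-1\<close> exactly when
  \<open>h(X, X) h(D, D)\<close> is the squared modulus of \<open>\<omega>\<^sub>c(X, D)\<close>.
  Here \<open>h(X, X) = 2 s dw/ds\<close>, \<open>h(D, D) = 4 s w\<close> and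
  \<open>\<omega>\<^sub>c(X, D) = - 4 s\<close>, which gives \<open>w dw/ds = 2\<close>; the 4 in
  \<open>- 4 s\<close> is the factor between Killing form and trace form. The obstacle is that
  tensor fields are ambient functions, while a derivative within the orbit is a choice that is well
  defined on tangent directions only. So each derivative is computed from an ambient formula that
  agrees with the field on the orbit, and every inserted vector, Lie brackets included, must first
  be shown tangent.\<close>

lemma higher_differentiable_on_cong:
  assumes "open S" "\<And>x. x \<in> S \<Longrightarrow> f x = g x" "higher_differentiable_on n S f"
  shows "higher_differentiable_on n S g"
  using assms(2,3)
proof (induction n arbitrary: f g)
  case 0
  then show ?case using continuous_on_cong[of S S f g] by simp
next
  case (Suc n)
  have d: "(g has_derivative frechet_derivative f (at x)) (at x)" if x: "x \<in> S" for x
  proof -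
    have "(f has_derivative frechet_derivative f (at x)) (at x)"
      using Suc.prems x by (simp flip: frechet_derivative_works)
    then show ?thesis
      by (rule has_derivative_transform_within_open[OF _ assms(1) x Suc.prems(1)])
  qed
  have "higher_differentiable_on n S (\<lambda>x. frechet_derivative g (at x) v)" for v
  proof (rule Suc.IH)
    show "frechet_derivative f (at x) v = frechet_derivative g (at x) v" if "x \<in> S" for x
      using frechet_derivative_at[OF d[OF that]] by simp
    show "higher_differentiable_on n S (\<lambda>x. frechet_derivative f (at x) v)"
      using Suc.prems(2) by simp
  qed
  then show ?case
    using differentiableI[OF d] by simp
qed

text \<open>Introduction rule with a derivative of known form in place of
  \<open>frechet_derivative\<close>. Closure under sums, products, inverses, roots and linear maps
  is an induction on the order through this rule.\<close>

lemma higher_differentiable_on_Suc: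
  assumes "open S" "\<And>x. x \<in> S \<Longrightarrow> (f has_derivative f' x) (at x)"
    and "\<And>v. higher_differentiable_on n S (\<lambda>x. f' x v)"
  shows "higher_differentiable_on (Suc n) S f"
proof -
  have "f' x v = frechet_derivative f (at x) v" if "x \<in> S" for x v
    using frechet_derivative_at[OF assms(2)[OF that]] by simp
  then have "higher_differentiable_on n S (\<lambda>x. frechet_derivative f (at x) v)" for v
    by (rule higher_differentiable_on_cong[OF assms(1) _ assms(3)])
  then show ?thesis
    using differentiableI[OF assms(2)] by simp
qed

lemma higher_differentiable_on_has_derivative:
  assumes "higher_differentiable_on (Suc n) S f" "x \<in> S"
  shows "(f has_derivative frechet_derivative f (at x)) (at x)"
  using assms by (simp flip: frechet_derivative_works)

lemma higher_differentiable_on_derivative: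
  "higher_differentiable_on (Suc n) S f \<Longrightarrow>
    higher_differentiable_on n S (\<lambda>x. frechet_derivative f (at x) v)"
  by simp

lemma higher_differentiable_on_SucD:
  "higher_differentiable_on (Suc n) S f \<Longrightarrow> higher_differentiable_on n S f"
proof (induction n arbitrary: f)
  case 0
  then have "f differentiable_on S"
    by (auto simp: differentiable_on_def intro: differentiable_at_withinI)
  then show ?case by (simp add: differentiable_imp_continuous_on)
next
  case (Suc n)
  then show ?case
    by (subst higher_differentiable_on.simps(2)) (metis higher_differentiable_on.simps(2))
qed

lemma higher_differentiable_on_subset:
  "higher_differentiable_on n S f \<Longrightarrow> R \<subseteq> S \<Longrightarrow> higher_differentiable_on n R f"
  by (induction n arbitrary: f) (auto intro: continuous_on_subset)

lemma higher_differentiable_on_const: "open S \<Longrightarrow> higher_differentiable_on n S (\<lambda>x. c)"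
proof (induction n arbitrary: c)
  case (Suc n)
  show ?case
    by (rule higher_differentiable_on_Suc[OF Suc.prems has_derivative_const Suc.IH[OF Suc.prems]])
qed simp

lemma higher_differentiable_on_ident: "open S \<Longrightarrow> higher_differentiable_on n S (\<lambda>x. x)"
proof (cases n)
  case (Suc m)
  assume "open S"
  then show ?thesis unfolding Suc
    by (intro higher_differentiable_on_Suc[OF _ has_derivative_ident higher_differentiable_on_const])
qed simp

lemma higher_differentiable_on_add:
  assumes "open S" "higher_differentiable_on n S f" "higher_differentiable_on n S g"
  shows "higher_differentiable_on n S (\<lambda>x. f x + g x)"
  using assms(2,3)
proof (induction n arbitrary: f g)
  case (Suc n)
  note d = Suc.prems[THEN higher_differentiable_on_has_derivative]
  show ?case
    by (rule higher_differentiable_on_Suc[OF assms(1) has_derivative_add[OF d]])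
      (assumption | intro Suc.IH Suc.prems[THEN higher_differentiable_on_derivative])+
qed (simp add: continuous_on_add)

lemma (in bounded_linear) higher_differentiable_on:
  assumes "open S" "higher_differentiable_on n S g"
  shows "higher_differentiable_on n S (\<lambda>x. f (g x))"
  using assms(2)
proof (induction n arbitrary: g)
  case (Suc n)
  note d = Suc.prems[THEN higher_differentiable_on_has_derivative]
  show ?case
    by (rule higher_differentiable_on_Suc[OF assms(1) has_derivative[OF d]])
      (assumption | intro Suc.IH Suc.prems[THEN higher_differentiable_on_derivative])+
qed (simp add: continuous_on)

lemma (in bounded_bilinear) higher_differentiable_on:
  assumes "open S" "higher_differentiable_on n S f" "higher_differentiable_on n S g"
  shows "higher_differentiable_on n S (\<lambda>x. prod (f x) (g x))"
  using assms(2,3)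
proof (induction n arbitrary: f g)
  case (Suc n)
  note d = Suc.prems[THEN higher_differentiable_on_has_derivative]
  show ?case
    by (rule higher_differentiable_on_Suc[OF assms(1) FDERIV[OF d]])
      (assumption | intro higher_differentiable_on_add[OF assms(1)] Suc.IH
        Suc.prems[THEN higher_differentiable_on_derivative] Suc.prems[THEN higher_differentiable_on_SucD])+
qed (simp add: continuous_on)

lemmas higher_differentiable_on_mult =
  bounded_bilinear.higher_differentiable_on[OF bounded_bilinear_mult]

text \<open>The derivative contains \<open>inverse (f x)\<close> again, so the induction keeps
  \<open>f\<close> fixed and applies its own conclusion at the lower order; the square root is
  treated the same way.\<close>

lemma higher_differentiable_on_inverse:
  fixes f :: "'a::real_normed_vector \<Rightarrow> real"
  assumes "open S" "\<And>x. x \<in> S \<Longrightarrow> f x \<noteq> 0" "higher_differentiable_on n S f"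
  shows "higher_differentiable_on n S (\<lambda>x. inverse (f x))"
  using assms(3)
proof (induction n)
  case 0
  then show ?case using assms(2) by (simp add: continuous_on_inverse)
next
  case (Suc n)
  note d = Suc.prems[THEN higher_differentiable_on_has_derivative]
  have i: "higher_differentiable_on n S (\<lambda>x. inverse (f x))"
    by (rule Suc.IH[OF higher_differentiable_on_SucD[OF Suc.prems]])
  show ?case
    by (rule higher_differentiable_on_Suc[OF assms(1) Deriv.has_derivative_inverse[OF assms(2) d]])
      (assumption | intro bounded_linear.higher_differentiable_on[OF bounded_linear_minus[OF bounded_linear_ident]]
        higher_differentiable_on_mult assms(1) i Suc.prems[THEN higher_differentiable_on_derivative])+
qed

lemma higher_differentiable_on_sqrt:
  fixes f :: "'a::real_normed_vector \<Rightarrow> real"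
  assumes "open S" "\<And>x. x \<in> S \<Longrightarrow> f x > 0" "higher_differentiable_on n S f"
  shows "higher_differentiable_on n S (\<lambda>x. sqrt (f x))"
  using assms(3)
proof (induction n)
  case 0
  then show ?case by (simp add: continuous_on_real_sqrt)
next
  case (Suc n)
  note d = Suc.prems[THEN higher_differentiable_on_has_derivative]
  have i: "higher_differentiable_on n S (\<lambda>x. sqrt (f x))"
    by (rule Suc.IH[OF higher_differentiable_on_SucD[OF Suc.prems]])
  have nz: "sqrt (f x) \<noteq> 0" if "x \<in> S" for x
    using assms(2)[OF that] by simp
  have e: "((\<lambda>x. sqrt (f x)) has_derivative
      (\<lambda>v. frechet_derivative f (at x) v * (inverse (sqrt (f x)) * (1 / 2)))) (at x)" if "x \<in> S" for x
    by (rule has_derivative_eq_rhs[OF has_derivative_real_sqrt[OF assms(2)[OF that] d[OF that]]])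
      (auto simp: field_simps)
  show ?case
    by (rule higher_differentiable_on_Suc[OF assms(1) e])
      (assumption | intro higher_differentiable_on_mult higher_differentiable_on_inverse
        higher_differentiable_on_const assms(1) i nz Suc.prems[THEN higher_differentiable_on_derivative])+
qed

lemma higher_differentiable_on_ln:
  fixes f :: "'a::real_normed_vector \<Rightarrow> real"
  assumes "open S" "\<And>x. x \<in> S \<Longrightarrow> f x > 0" "higher_differentiable_on n S f"
  shows "higher_differentiable_on n S (\<lambda>x. ln (f x))"
proof (cases n)
  case 0
  have "\<forall>x\<in>S. f x \<noteq> 0" using assms(2) by fastforce
  then show ?thesis using 0 assms(3) by (simp add: continuous_on_ln)
next
  case (Suc m)
  note h = assms(3)[unfolded Suc]
  note d = higher_differentiable_on_has_derivative[OF h]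
  have nz: "f x \<noteq> 0" if "x \<in> S" for x
    using assms(2)[OF that] by simp
  have e: "((\<lambda>x. ln (f x)) has_derivative (\<lambda>v. frechet_derivative f (at x) v * inverse (f x))) (at x)"
    if "x \<in> S" for x
    using has_derivative_ln[OF assms(2)[OF that] d[OF that]] .
  show ?thesis unfolding Suc
    by (rule higher_differentiable_on_Suc[OF assms(1) e])
      (assumption | intro higher_differentiable_on_mult higher_differentiable_on_inverse
        higher_differentiable_on_SucD[OF h] higher_differentiable_on_derivative[OF h] assms(1) nz)+
qed

lemma higher_differentiable_on_compose_linear:
  assumes L: "bounded_linear L" and "open S" "higher_differentiable_on n S f"
  shows "higher_differentiable_on n (L -` S) (\<lambda>x. f (L x))"
  using assms(3)
proof (induction n arbitrary: f)
  case 0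
  then show ?case
    using continuous_on_compose2[of S f "L -` S" L] linear_continuous_on[OF L] by auto
next
  case (Suc n)
  have o: "open (L -` S)"
    using L \<open>open S\<close> by (auto intro: open_vimage linear_continuous_on)
  have "((\<lambda>x. f (L x)) has_derivative (\<lambda>v. frechet_derivative f (at (L x)) (L v))) (at x)"
    if "x \<in> L -` S" for x
    using that higher_differentiable_on_has_derivative[OF Suc.prems]
    by (intro has_derivative_compose[OF bounded_linear_imp_has_derivative[OF L]]) auto
  then show ?case
    by (rule higher_differentiable_on_Suc[OF o])
      (assumption | intro Suc.IH Suc.prems[THEN higher_differentiable_on_derivative])+
qed

section \<open>Smooth maps on arbitrary subsets\<close>

lemma smooth_map_onE:
  assumes "smooth_map_on M f" "x \<in> M"
  obtains W F where "open W" "x \<in> W" "\<And>n. higher_differentiable_on n W F"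
    "\<And>y. y \<in> M \<Longrightarrow> y \<in> W \<Longrightarrow> F y = f y"
proof -
  obtain W F where "open W \<and> x \<in> W \<and> (\<forall>n. higher_differentiable_on n W F) \<and> (\<forall>y\<in>M \<inter> W. F y = f y)"
    using bspec[OF assms(1)[unfolded smooth_map_on_def] assms(2)] by (elim exE)
  then show thesis by (intro that[of W F]) simp_all
qed

lemma smooth_map_onI:
  assumes "\<And>x. x \<in> M \<Longrightarrow> \<exists>W F. open W \<and> x \<in> W \<and> (\<forall>n. higher_differentiable_on n W F)
    \<and> (\<forall>y\<in>M. y \<in> W \<longrightarrow> F y = f y)"
  shows "smooth_map_on M f"
  using assms by (simp add: smooth_map_on_def Ball_def imp_conjL)

lemma smooth_map_onI_open:
  assumes "open W" "M \<subseteq> W" "\<And>n. higher_differentiable_on n W f"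
  shows "smooth_map_on M f"
  using assms by (intro smooth_map_onI exI[of _ W] exI[of _ f]) auto

lemma smooth_map_on_const: "smooth_map_on M (\<lambda>x. c)"
  by (rule smooth_map_onI_open[OF open_UNIV]) (auto intro: higher_differentiable_on_const)

lemma smooth_map_on_ident: "smooth_map_on M (\<lambda>x. x)"
  by (rule smooth_map_onI_open[OF open_UNIV]) (auto intro: higher_differentiable_on_ident)

text \<open>The two local extensions live on different neighbourhoods of the point; the operation is
  applied to the extensions on the intersection.\<close>

lemma smooth_map_on_binary:
  fixes M :: "'a::real_normed_vector set"
  assumes f: "smooth_map_on M f" and g: "smooth_map_on M g"
    and op: "\<And>(W :: 'a set) F G n. open W \<Longrightarrow> higher_differentiable_on n W F \<Longrightarrow> higher_differentiable_on n W G
      \<Longrightarrow> higher_differentiable_on n W (\<lambda>x. b (F x) (G x))"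
  shows "smooth_map_on M (\<lambda>x. b (f x) (g x))"
proof (rule smooth_map_onI)
  fix x assume x: "x \<in> M"
  obtain V F where F: "open V" "x \<in> V" "\<And>n. higher_differentiable_on n V F"
    "\<And>y. y \<in> M \<Longrightarrow> y \<in> V \<Longrightarrow> F y = f y"
    using smooth_map_onE[OF f x] by metis
  obtain W G where G: "open W" "x \<in> W" "\<And>n. higher_differentiable_on n W G"
    "\<And>y. y \<in> M \<Longrightarrow> y \<in> W \<Longrightarrow> G y = g y"
    using smooth_map_onE[OF g x] by metis
  have hd: "higher_differentiable_on n (V \<inter> W) (\<lambda>x. b (F x) (G x))" for n
    using F(1) G(1) higher_differentiable_on_subset[OF F(3)] higher_differentiable_on_subset[OF G(3)]
    by (intro op open_Int) simp_all
  show "\<exists>W H. open W \<and> x \<in> W \<and> (\<forall>n. higher_differentiable_on n W H) \<and> (\<forall>y\<in>M. y \<in> W \<longrightarrow> H y = b (f y) (g y))"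
    using F(1,2,4) G(1,2,4) hd open_Int[of V W]
    by (intro exI[of _ "V \<inter> W"] exI[of _ "\<lambda>x. b (F x) (G x)"]) simp
qed

lemma smooth_map_on_unary:
  fixes M :: "'a::real_normed_vector set" and u :: "'b::real_normed_vector \<Rightarrow> 'c::real_normed_vector"
  assumes f: "smooth_map_on M f" and U: "open U" "\<And>x. x \<in> M \<Longrightarrow> f x \<in> U"
    and op: "\<And>(W :: 'a set) F n. open W \<Longrightarrow> (\<And>x. x \<in> W \<Longrightarrow> F x \<in> U) \<Longrightarrow> higher_differentiable_on n W F
      \<Longrightarrow> higher_differentiable_on n W (\<lambda>x. u (F x))"
  shows "smooth_map_on M (\<lambda>x. u (f x))"
proof (rule smooth_map_onI)
  fix x assume x: "x \<in> M"
  obtain V F where F: "open V" "x \<in> V" "\<And>n. higher_differentiable_on n V F"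
    "\<And>y. y \<in> M \<Longrightarrow> y \<in> V \<Longrightarrow> F y = f y"
    using smooth_map_onE[OF f x] by metis
  \<comment> \<open>The extension \<open>F\<close> may leave \<open>U\<close> away from
    \<open>M\<close>, so its domain is cut down to the preimage of \<open>U\<close>.\<close>
  have "continuous_on V F" using F(3)[of 0] by simp
  then have o: "open (V \<inter> F -` U)"
    using F(1) U(1) by (simp add: continuous_on_open_vimage Int_commute)
  have hd: "higher_differentiable_on n (V \<inter> F -` U) (\<lambda>x. u (F x))" for n
    using o higher_differentiable_on_subset[OF F(3)] by (intro op) simp_all
  show "\<exists>W H. open W \<and> x \<in> W \<and> (\<forall>n. higher_differentiable_on n W H) \<and> (\<forall>y\<in>M. y \<in> W \<longrightarrow> H y = u (f y))"
    using F(2,4) U x o hd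
    by (intro exI[of _ "V \<inter> F -` U"] exI[of _ "\<lambda>x. u (F x)"]) simp
qed

lemma smooth_map_on_add:
  "smooth_map_on M f \<Longrightarrow> smooth_map_on M g \<Longrightarrow> smooth_map_on M (\<lambda>x. f x + g x)"
  by (rule smooth_map_on_binary) (auto intro: higher_differentiable_on_add)

lemma (in bounded_bilinear) smooth_map_on:
  "smooth_map_on M f \<Longrightarrow> smooth_map_on M g \<Longrightarrow> smooth_map_on M (\<lambda>x. prod (f x) (g x))"
  by (rule smooth_map_on_binary[where b = prod]) (auto intro: higher_differentiable_on)

lemma (in bounded_linear) smooth_map_on:
  "smooth_map_on M g \<Longrightarrow> smooth_map_on M (\<lambda>x. f (g x))"
  by (rule smooth_map_on_unary[OF _ open_UNIV]) (auto intro: higher_differentiable_on)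

lemmas smooth_map_on_mult = bounded_bilinear.smooth_map_on[OF bounded_bilinear_mult]
lemmas smooth_map_on_inner = bounded_bilinear.smooth_map_on[OF bounded_bilinear_inner]
lemmas smooth_map_on_minus =
  bounded_linear.smooth_map_on[OF bounded_linear_minus[OF bounded_linear_ident]]

lemma smooth_map_on_diff:
  "smooth_map_on M f \<Longrightarrow> smooth_map_on M g \<Longrightarrow> smooth_map_on M (\<lambda>x. f x - g x)"
  using smooth_map_on_add[of M f "\<lambda>x. - g x"] smooth_map_on_minus[of M g] by simp

lemma smooth_map_on_inverse:
  "smooth_map_on M f \<Longrightarrow> (\<And>x. x \<in> M \<Longrightarrow> f x \<noteq> (0::real)) \<Longrightarrow> smooth_map_on M (\<lambda>x. inverse (f x))"
  by (rule smooth_map_on_unary[where U = "- {0}"]) (auto intro!: higher_differentiable_on_inverse)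

lemma smooth_map_on_divide:
  "smooth_map_on M f \<Longrightarrow> smooth_map_on M g \<Longrightarrow> (\<And>x. x \<in> M \<Longrightarrow> g x \<noteq> (0::real)) \<Longrightarrow>
    smooth_map_on M (\<lambda>x. f x / g x)"
  unfolding divide_inverse by (intro smooth_map_on_mult smooth_map_on_inverse)

lemma smooth_map_on_sqrt:
  "smooth_map_on M f \<Longrightarrow> (\<And>x. x \<in> M \<Longrightarrow> f x > 0) \<Longrightarrow> smooth_map_on M (\<lambda>x. sqrt (f x))"
  by (rule smooth_map_on_unary[where U = "{0<..}"]) (auto intro!: higher_differentiable_on_sqrt)

lemma smooth_map_on_ln:
  "smooth_map_on M f \<Longrightarrow> (\<And>x. x \<in> M \<Longrightarrow> f x > 0) \<Longrightarrow> smooth_map_on M (\<lambda>x. ln (f x) :: real)"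
  by (rule smooth_map_on_unary[where U = "{0<..}"]) (auto intro!: higher_differentiable_on_ln)

lemma smooth_map_on_compose_linear:
  assumes "bounded_linear L" "smooth_map_on M f" "\<And>x. x \<in> M' \<Longrightarrow> L x \<in> M"
  shows "smooth_map_on M' (\<lambda>x. f (L x))"
proof (rule smooth_map_onI)
  fix x assume x: "x \<in> M'"
  obtain V F where F: "open V" "L x \<in> V" "\<And>n. higher_differentiable_on n V F"
    "\<And>y. y \<in> M \<Longrightarrow> y \<in> V \<Longrightarrow> F y = f y"
    using smooth_map_onE[OF assms(2) assms(3)[OF x]] by metis
  have o: "open (L -` V)"
    using assms(1) F(1) by (auto intro: open_vimage linear_continuous_on)
  show "\<exists>W H. open W \<and> x \<in> W \<and> (\<forall>n. higher_differentiable_on n W H) \<and> (\<forall>y\<in>M'. y \<in> W \<longrightarrow> H y = f (L y))"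
    using F(2,4) assms(3) o higher_differentiable_on_compose_linear[OF assms(1) F(1) F(3)]
    by (intro exI[of _ "L -` V"] exI[of _ "\<lambda>x. F (L x)"]) simp
qed

lemma smooth_map_on_differentiable:
  assumes "smooth_map_on M f" "x \<in> M"
  shows "f differentiable (at x within M)"
proof -
  obtain V F where F: "open V" "x \<in> V" "\<And>n. higher_differentiable_on n V F"
    "\<And>y. y \<in> M \<Longrightarrow> y \<in> V \<Longrightarrow> F y = f y"
    using smooth_map_onE[OF assms] by metis
  have d: "(F has_derivative frechet_derivative F (at x)) (at x within M)"
    using higher_differentiable_on_has_derivative[OF F(3)[of "Suc 0"] F(2)] by (rule has_derivative_at_withinI)
  obtain e where "e > 0" "ball x e \<subseteq> V"
    using F(1,2) openE by blast
  then have "(f has_derivative frechet_derivative F (at x)) (at x within M)"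
    using F(4) by (intro has_derivative_transform_within[OF d _ assms(2)]) (auto simp: dist_commute subset_iff)
  then show ?thesis by (rule differentiableI)
qed

subsection \<open>The nilpotent orbit and its tangent spaces\<close>

text \<open>Complex scalar multiplication as a matrix product, so that \<open>I_nat\<close> is the
  case \<open>z = \<i>\<close>.\<close>

definition cscale :: "complex \<Rightarrow> mat2 \<Rightarrow> mat2" (infixr "*\<^sub>C" 75) where
  "z *\<^sub>C Y = mat z ** Y"

definition adjoint_mat :: "mat2 \<Rightarrow> mat2" where
  "adjoint_mat Y = map_matrix cnj (transpose Y)"

text \<open>The Hermitian product, linear in the first argument, whose real part is the Euclidean
  inner product of \<open>mat2\<close> (\<open>Re_herm\<close>).\<close>

definition herm :: "mat2 \<Rightarrow> mat2 \<Rightarrow> complex" where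
  "herm Y Z = trace (Y ** adjoint_mat Z)"

lemma mat2_eq_iff:
  "(A :: mat2) = B \<longleftrightarrow> A$1$1 = B$1$1 \<and> A$1$2 = B$1$2 \<and> A$2$1 = B$2$1 \<and> A$2$2 = B$2$2"
  by (auto simp: vec_eq_iff forall_2)

lemma mat2_mult_nth: "((A :: mat2) ** B) $ i $ j = A$i$1 * B$1$j + A$i$2 * B$2$j"
  by (simp add: matrix_matrix_mult_def sum_2)

lemma mat_2_nth:
  "(mat c :: mat2) $ 1 $ 1 = c" "(mat c :: mat2) $ 1 $ 2 = 0"
  "(mat c :: mat2) $ 2 $ 1 = 0" "(mat c :: mat2) $ 2 $ 2 = c"
  by (simp_all add: mat_def)

lemma cscale_nth: "(z *\<^sub>C Y) $ i $ j = z * Y $ i $ j"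
  using exhaust_2[of i] by (auto simp: cscale_def mat2_mult_nth mat_2_nth)

lemma adjoint_mat_nth: "adjoint_mat Y $ i $ j = cnj (Y $ j $ i)"
  by (simp add: adjoint_mat_def map_matrix_def transpose_def)

lemma trace_2: "trace (A :: mat2) = A$1$1 + A$2$2"
  by (simp add: trace_def sum_2)

lemma bracket_nth:
  "bracket A B $ i $ j = A$i$1 * B$1$j + A$i$2 * B$2$j - (B$i$1 * A$1$j + B$i$2 * A$2$j)"
  by (simp add: bracket_def mat2_mult_nth)

lemma herm_nth: "herm Y Z =
  Y$1$1 * cnj (Z$1$1) + Y$1$2 * cnj (Z$1$2) + (Y$2$1 * cnj (Z$2$1) + Y$2$2 * cnj (Z$2$2))"
  by (simp add: herm_def trace_2 mat2_mult_nth adjoint_mat_nth)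

lemmas mat2_simps = mat2_eq_iff mat2_mult_nth mat_2_nth cscale_nth adjoint_mat_nth trace_2
  bracket_nth herm_nth

lemma bounded_bilinear_bracket: "bounded_bilinear bracket"
  unfolding bilinear_conv_bounded_bilinear[symmetric] bilinear_def
  by (auto intro!: linearI simp: mat2_simps algebra_simps)

lemma bounded_bilinear_cscale: "bounded_bilinear (*\<^sub>C)"
  unfolding bilinear_conv_bounded_bilinear[symmetric] bilinear_def
  by (auto intro!: linearI simp: mat2_simps algebra_simps)

lemma bounded_bilinear_herm: "bounded_bilinear herm"
  unfolding bilinear_conv_bounded_bilinear[symmetric] bilinear_def
  by (auto intro!: linearI simp: mat2_simps algebra_simps)

lemma bounded_linear_adjoint_mat: "bounded_linear adjoint_mat"
  unfolding linear_conv_bounded_linear[symmetric]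
  by (auto intro!: linearI simp: mat2_simps)

interpretation bracket: bounded_bilinear bracket by (rule bounded_bilinear_bracket)
interpretation cscale: bounded_bilinear "(*\<^sub>C)" by (rule bounded_bilinear_cscale)
interpretation herm: bounded_bilinear herm by (rule bounded_bilinear_herm)

lemmas adjoint_mat_add = linear_add[OF bounded_linear.linear[OF bounded_linear_adjoint_mat]]

lemma cscale_cscale: "w *\<^sub>C z *\<^sub>C Y = (w * z) *\<^sub>C Y"
  by (simp add: mat2_simps)

lemma cscale_of_real: "of_real r *\<^sub>C Y = r *\<^sub>R Y"
  by (simp add: mat2_simps) (simp add: scaleR_conv_of_real)

lemma cscale_one [simp]: "1 *\<^sub>C Y = Y"
  by (simp add: mat2_simps)

lemma herm_cscale_left: "herm (z *\<^sub>C Y) Z = z * herm Y Z"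
  by (simp add: mat2_simps algebra_simps)

lemma herm_cscale_right: "herm Y (z *\<^sub>C Z) = cnj z * herm Y Z"
  by (simp add: mat2_simps algebra_simps)

lemma bracket_cscale_left: "bracket (z *\<^sub>C Y) Z = z *\<^sub>C bracket Y Z"
  by (simp add: mat2_simps algebra_simps)

lemma bracket_cscale_right: "bracket Y (z *\<^sub>C Z) = z *\<^sub>C bracket Y Z"
  by (simp add: mat2_simps algebra_simps)

lemma adjoint_cscale: "adjoint_mat (z *\<^sub>C Y) = cnj z *\<^sub>C adjoint_mat Y"
  by (simp add: mat2_simps)

lemma cnj_herm: "cnj (herm Y Z) = herm Z Y"
  by (simp add: mat2_simps algebra_simps)

lemma Re_herm: "Re (herm Y Z) = Y \<bullet> Z"
  by (simp add: herm_nth inner_vec_def sum_2 inner_complex_def algebra_simps)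

lemma herm_self: "herm Y Y = of_real (Y \<bullet> Y)"
  using cnj_herm[of Y Y] by (simp add: complex_eq_iff Re_herm)

lemma I_nat_cscale: "I_nat X Y = \<i> *\<^sub>C Y"
  by (simp add: I_nat_def cscale_def)

section \<open>Killing form and equations of the orbit\<close>

lemma sl2_iff: "A \<in> sl2 \<longleftrightarrow> A$2$2 = - A$1$1"
  by (auto simp: sl2_def trace_2 add_eq_0_iff)

text \<open>The Killing form of sl(n) is 2n times the trace form; here n = 2, and the sign is that
  of \<open>inner_sl2\<close>.\<close>

lemma inner_sl2_trace:
  assumes "A \<in> sl2" "B \<in> sl2"
  shows "inner_sl2 A B = - 4 * trace (A ** B)"
  using assms unfolding inner_sl2_def killing_form_def sl2_endo_trace_def sl2_iff
  by (simp add: mat2_simps vector_2 algebra_simps)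

text \<open>The right-hand side is \<open>- det X\<close>. Multiplicativity of the determinant gives
  one direction, and Cayley-Hamilton for a traceless matrix, \<open>X ** X = - det X\<close>, the
  other.\<close>

lemma nilpotent_matrix_iff:
  assumes "X \<in> sl2"
  shows "nilpotent_matrix X \<longleftrightarrow> X$1$1 * X$1$1 + X$1$2 * X$2$1 = 0"
proof
  assume "nilpotent_matrix X"
  then obtain k where k: "(((**) X) ^^ k) (mat 1) = 0"
    unfolding nilpotent_matrix_def by blast
  have "det ((((**) X) ^^ k) (mat 1)) = det X ^ k"
    by (induction k) (simp_all add: det_mul)
  moreover have "det (0 :: mat2) = 0"
    by (simp add: det_2)
  ultimately have "det X = 0"
    by (simp add: k)
  then show "X$1$1 * X$1$1 + X$1$2 * X$2$1 = 0"
    using assms by (simp add: det_2 sl2_iff add_eq_0_iff)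
next
  assume "X$1$1 * X$1$1 + X$1$2 * X$2$1 = 0"
  then have "(((**) X) ^^ 2) (mat 1) = 0"
    using assms by (simp add: mat2_simps sl2_iff numeral_2_eq_2 algebra_simps)
  then show "nilpotent_matrix X" unfolding nilpotent_matrix_def by blast
qed

lemma nil_orbit_iff:
  "X \<in> nil_orbit \<longleftrightarrow> X$2$2 = - X$1$1 \<and> X$1$1 * X$1$1 + X$1$2 * X$2$1 = 0 \<and> X \<noteq> 0"
  unfolding nil_orbit_def using nilpotent_matrix_iff[of X] by (auto simp: sl2_iff)

text \<open>The double cover of the orbit by \<open>\<complex>\<^sup>2 - {0}\<close> removes the quadratic relation between
  the matrix entries, so that identities on the orbit become polynomial identities.\<close>

lemma nil_orbit_spinor:
  assumes "X \<in> nil_orbit"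
  obtains a b where "X$1$1 = a * b" "X$1$2 = - (a * a)" "X$2$1 = b * b" "X$2$2 = - (a * b)"
    "a \<noteq> 0 \<or> b \<noteq> 0"
proof (cases "X$1$2 = 0")
  case True
  then have x: "X$1$1 = 0" "X$2$2 = 0" and "X$2$1 \<noteq> 0"
    using assms by (auto simp: nil_orbit_iff mat2_eq_iff)
  define b where "b = csqrt (X$2$1)"
  have b: "b * b = X$2$1"
    by (simp add: b_def flip: power2_eq_square)
  show thesis
    using True x b \<open>X$2$1 \<noteq> 0\<close> by (intro that[of 0 b]) auto
next
  case False
  define a where "a = csqrt (- X$1$2)"
  have a: "a * a = - X$1$2"
    by (simp add: a_def flip: power2_eq_square)
  with False have "a \<noteq> 0" by auto
  have "X$2$1 * (a * a) = X$1$1 * X$1$1"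
    using assms unfolding a nil_orbit_iff by (simp add: algebra_simps add_eq_0_iff)
  then have "X$2$1 = X$1$1 / a * (X$1$1 / a)"
    using \<open>a \<noteq> 0\<close> by (simp add: field_simps)
  then show thesis
    using assms a \<open>a \<noteq> 0\<close> by (intro that[of a "X$1$1 / a"]) (auto simp: nil_orbit_iff)
qed

text \<open>Up to scaling, \<open>X\<close>, \<open>adjoint_mat X\<close> and
  \<open>frame2 X\<close> form an sl(2)-triple, with \<open>frame2 X\<close> as the semisimple
  element; this is the source of the relations in \<open>herm_frame\<close>.\<close>

definition frame2 :: "mat2 \<Rightarrow> mat2" where
  "frame2 X = bracket X (adjoint_mat X)"

lemma nil_orbit_inner_pos: "X \<in> nil_orbit \<Longrightarrow> X \<bullet> X > 0"
  by (simp add: nil_orbit_iff)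

lemma herm_frame:
  assumes "X \<in> nil_orbit"
  shows "herm X (frame2 X) = 0" "herm (frame2 X) X = 0"
    "herm (frame2 X) (frame2 X) = of_real (2 * (X \<bullet> X)\<^sup>2)"
    "bracket X (frame2 X) = of_real (- 2 * (X \<bullet> X)) *\<^sub>C X"
    "adjoint_mat (frame2 X) = frame2 X"
proof -
  obtain a b where X: "X$1$1 = a * b" "X$1$2 = - (a * a)" "X$2$1 = b * b" "X$2$2 = - (a * b)"
    using nil_orbit_spinor[OF assms] by metis
  have N: "of_real (X \<bullet> X) = herm X X" by (simp add: herm_self)
  show "herm X (frame2 X) = 0" "herm (frame2 X) X = 0"
    "adjoint_mat (frame2 X) = frame2 X"
    by (simp_all add: mat2_simps frame2_def X algebra_simps)
  show "herm (frame2 X) (frame2 X) = of_real (2 * (X \<bullet> X)\<^sup>2)"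
    by (simp add: N) (simp add: mat2_simps frame2_def X algebra_simps power2_eq_square)
  show "bracket X (frame2 X) = of_real (- 2 * (X \<bullet> X)) *\<^sub>C X"
    by (simp add: N) (simp add: mat2_simps frame2_def X algebra_simps)
qed

lemma bracket_mem_sl2: "bracket A B \<in> sl2"
  by (simp add: sl2_iff bracket_nth algebra_simps)

lemma adjoint_mat_mem_sl2: "A \<in> sl2 \<Longrightarrow> adjoint_mat A \<in> sl2"
  by (simp add: sl2_iff adjoint_mat_nth)

lemma cscale_mem_sl2: "A \<in> sl2 \<Longrightarrow> z *\<^sub>C A \<in> sl2"
  by (simp add: sl2_iff cscale_nth)

lemma nil_orbit_mem_sl2: "X \<in> nil_orbit \<Longrightarrow> X \<in> sl2"
  by (simp add: nil_orbit_def)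

lemma tangentI: "A \<in> sl2 \<Longrightarrow> bracket A X \<in> tangent X"
  by (auto simp: tangent_def \<xi>_def)

lemma bracket_mem_tangent: "A \<in> sl2 \<Longrightarrow> bracket X A \<in> tangent X"
proof -
  assume "A \<in> sl2"
  then have "bracket (- A) X \<in> tangent X" by (intro tangentI) (simp add: sl2_iff)
  also have "bracket (- A) X = bracket X A" by (simp add: mat2_simps)
  finally show ?thesis .
qed

lemma tangent_add: "Y \<in> tangent X \<Longrightarrow> Z \<in> tangent X \<Longrightarrow> Y + Z \<in> tangent X"
  unfolding tangent_def \<xi>_def by (auto simp: sl2_iff simp flip: bracket.add_left)

lemma tangent_cscale: "Y \<in> tangent X \<Longrightarrow> z *\<^sub>C Y \<in> tangent X"
  unfolding tangent_def \<xi>_def by (auto simp: cscale_mem_sl2 simp flip: bracket_cscale_left)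

lemma tangent_scaleR: "Y \<in> tangent X \<Longrightarrow> r *\<^sub>R Y \<in> tangent X"
  using tangent_cscale[of Y X "of_real r"] by (simp add: cscale_of_real)

lemma frame2_mem_tangent: "X \<in> nil_orbit \<Longrightarrow> frame2 X \<in> tangent X"
  unfolding frame2_def by (intro bracket_mem_tangent adjoint_mat_mem_sl2 nil_orbit_mem_sl2)

text \<open>The orbit is a cone, so the radial direction is tangent; the witness is the triple
  relation \<open>[X, frame2 X] = - 2 s X\<close>.\<close>

lemma self_mem_tangent:
  assumes "X \<in> nil_orbit" shows "X \<in> tangent X"
proof -
  have "X = (of_real (- 1 / (2 * (X \<bullet> X)))) *\<^sub>C bracket X (frame2 X)"
    using nil_orbit_inner_pos[OF assms]
    by (simp add: herm_frame[OF assms] cscale_cscale flip: of_real_mult)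
  also have "\<dots> \<in> tangent X"
    unfolding frame2_def by (intro tangent_cscale bracket_mem_tangent bracket_mem_sl2)
  finally show ?thesis .
qed

text \<open>The two equations are the linearisations of \<open>trace X = 0\<close> and
  \<open>trace (X ** X) = 0\<close>. They turn tangency into linear conditions that can be
  differentiated along the orbit.\<close>

lemma tangent_trace_iff:
  assumes "X \<in> nil_orbit"
  shows "Y \<in> tangent X \<longleftrightarrow> trace Y = 0 \<and> trace (X ** Y) = 0" (is ?A)
    and tangent_frame: "Y \<in> tangent X \<Longrightarrow> \<exists>y1 y2. Y = y1 *\<^sub>C X + y2 *\<^sub>C frame2 X"
proof -
  have fwd: "trace Y = 0 \<and> trace (X ** Y) = 0" if Y: "Y \<in> tangent X"
  proof -
    obtain a b where X: "X$1$1 = a * b" "X$1$2 = - (a * a)" "X$2$1 = b * b" "X$2$2 = - (a * b)"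
      using nil_orbit_spinor[OF assms] by metis
    obtain A where A: "A \<in> sl2" "Y = bracket A X"
      using Y by (auto simp: tangent_def \<xi>_def)
    show ?thesis
      using A(1) unfolding A(2) by (simp add: mat2_simps sl2_iff X algebra_simps)
  qed
  have frame: "\<exists>y1 y2. Y = y1 *\<^sub>C X + y2 *\<^sub>C frame2 X" if tr: "trace Y = 0 \<and> trace (X ** Y) = 0"
  proof -
    obtain a b where X: "X$1$1 = a * b" "X$1$2 = - (a * a)" "X$2$1 = b * b" "X$2$2 = - (a * b)"
      and ab: "a \<noteq> 0 \<or> b \<noteq> 0"
      using nil_orbit_spinor[OF assms] by metis
    have Y22: "Y$2$2 = - Y$1$1" using tr by (simp add: trace_2 add_eq_0_iff)
    have rel: "2 * a * b * Y$1$1 - a * a * Y$2$1 + b * b * Y$1$2 = 0"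
      using tr by (simp add: mat2_simps X Y22 algebra_simps)
    \<comment> \<open>The vector \<open>(p, q)\<close> is a lift of \<open>Y\<close> to the double
      cover: the right-hand sides are the differential of
      \<open>(a, b) \<mapsto> (a b, - a\<^sup>2, b\<^sup>2)\<close>.\<close>
    obtain p q where pq: "Y$1$1 = a * q + b * p" "Y$1$2 = - (2 * a * p)" "Y$2$1 = 2 * b * q"
    proof (cases "a = 0")
      case True
      with ab have "b \<noteq> 0" by simp
      then show thesis
        using rel True by (intro that[of "Y$2$1 / (2 * b)" "Y$1$1 / b"]) (auto simp: field_simps)
    next
      case False
      define p q where "p = - Y$1$2 / (2 * a)" and "q = (Y$1$1 - b * p) / a"
      have p: "Y$1$2 = - (2 * a * p)" and q: "Y$1$1 = a * q + b * p"
        using False by (simp_all add: p_def q_def field_simps)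
      have "a * a * (Y$2$1 - 2 * b * q) = 0"
        using rel unfolding p q by algebra
      with False p q show thesis by (intro that[of q p]) auto
    qed
    define n where "n = a * cnj a + b * cnj b"
    have "n = of_real ((cmod a)\<^sup>2 + (cmod b)\<^sup>2)"
      by (simp add: n_def flip: complex_norm_square)
    with ab have n: "n \<noteq> 0"
      by (smt (verit, best) of_real_eq_0_iff sum_power2_eq_zero_iff norm_eq_zero)
    \<comment> \<open>By homogeneity of degree two \<open>(a, b) / 2\<close> lifts \<open>X\<close>,
      and \<open>n (- cnj b, cnj a)\<close> lifts \<open>frame2 X\<close>. These lifts are
      orthogonal, so \<open>y1\<close> and \<open>y2\<close> are the Hermitian projections of
      \<open>(p, q)\<close> onto them.\<close>
    define y1 y2 where "y1 = 2 * (p * cnj a + q * cnj b) / n" and "y2 = (a * q - b * p) / (n * n)"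
    have p: "p = y1 * a / 2 - y2 * n * cnj b" and q: "q = y1 * b / 2 + y2 * n * cnj a"
      using n by (simp_all add: y1_def y2_def field_simps, simp_all add: n_def algebra_simps)
    have "Y = y1 *\<^sub>C X + y2 *\<^sub>C frame2 X"
      by (simp add: mat2_simps frame2_def X Y22 pq) (simp add: p q n_def algebra_simps)
    then show ?thesis by blast
  qed
  show ?A
    using fwd frame assms
    by (auto intro!: tangent_add tangent_cscale self_mem_tangent frame2_mem_tangent)
  show "Y \<in> tangent X \<Longrightarrow> \<exists>y1 y2. Y = y1 *\<^sub>C X + y2 *\<^sub>C frame2 X"
    using fwd frame by blast
qed

subsection \<open>Exterior calculus and the Nijenhuis tensor on the orbit\<close>

lemma tangent_diff: "Y \<in> tangent X \<Longrightarrow> Z \<in> tangent X \<Longrightarrow> Y - Z \<in> tangent X"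
  using tangent_add[of Y X "- Z"] tangent_scaleR[of Z X "- 1"] by simp

section \<open>Differentiation within the orbit\<close>

lemma tangent_curve:
  assumes X: "X \<in> nil_orbit" and Y: "Y \<in> tangent X"
  obtains Z e where "e > 0" "\<And>t. \<bar>t\<bar> < e \<Longrightarrow> X + t *\<^sub>R Y + t\<^sup>2 *\<^sub>R Z \<in> nil_orbit"
proof -
  obtain A where A: "A \<in> sl2" "Y = bracket A X"
    using Y by (auto simp: tangent_def \<xi>_def)
  obtain a b where ab: "X$1$1 = a * b" "X$1$2 = - (a * a)" "X$2$1 = b * b" "X$2$2 = - (a * b)"
    using nil_orbit_spinor[OF X] by metis
  \<comment> \<open>This is \<open>(1 + t A) X (1 - t A)\<close>, where \<open>1 - t A\<close> is
    the adjugate of \<open>1 + t A\<close> because \<open>A\<close> is traceless. On the double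
    cover it is the straight line \<open>(a, b) + t (p, q)\<close> with
    \<open>(p, q) = A (a, b)\<close>.\<close>
  define \<gamma> where "\<gamma> t = X + t *\<^sub>R Y + t\<^sup>2 *\<^sub>R (- (A ** X ** A))" for t :: real
  have "isCont \<gamma> 0"
    unfolding \<gamma>_def by (intro continuous_intros)
  moreover have "\<gamma> 0 \<noteq> 0"
    using X by (simp add: \<gamma>_def nil_orbit_iff)
  ultimately have "\<forall>\<^sub>F t in at 0. \<gamma> t \<noteq> 0"
    unfolding isCont_def by (rule tendsto_imp_eventually_ne)
  then obtain e where e: "e > 0" "\<And>t. t \<noteq> 0 \<Longrightarrow> \<bar>t\<bar> < e \<Longrightarrow> \<gamma> t \<noteq> 0"
    by (auto simp: eventually_at)
  have "\<gamma> t $ 2 $ 2 = - \<gamma> t $ 1 $ 1 \<and> \<gamma> t $ 1 $ 1 * \<gamma> t $ 1 $ 1 + \<gamma> t $ 1 $ 2 * \<gamma> t $ 2 $ 1 = 0" for t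
  proof -
    define p q where "p = A$1$1 * a + A$1$2 * b" and "q = A$2$1 * a - A$1$1 * b"
    have A22: "A$2$2 = - A$1$1" using A(1) by (simp add: sl2_iff)
    have \<gamma>_nth: "\<gamma> t $ 1 $ 1 = (a + of_real t * p) * (b + of_real t * q)"
      "\<gamma> t $ 1 $ 2 = - ((a + of_real t * p) * (a + of_real t * p))"
      "\<gamma> t $ 2 $ 1 = (b + of_real t * q) * (b + of_real t * q)"
      "\<gamma> t $ 2 $ 2 = - ((a + of_real t * p) * (b + of_real t * q))"
      by (simp_all add: \<gamma>_def A(2) mat2_mult_nth bracket_nth ab A22 scaleR_conv_of_real[where 'a=complex])
        (simp_all add: p_def q_def algebra_simps power2_eq_square)
    show ?thesis unfolding \<gamma>_nth by (simp add: algebra_simps)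
  qed
  moreover have "\<gamma> t \<noteq> 0" if "\<bar>t\<bar> < e" for t
    using e(2)[OF _ that] \<open>\<gamma> 0 \<noteq> 0\<close> by (cases "t = 0") auto
  ultimately have "\<gamma> t \<in> nil_orbit" if "\<bar>t\<bar> < e" for t
    using that by (simp add: nil_orbit_iff)
  then show thesis
    using that e(1) unfolding \<gamma>_def by blast
qed

text \<open>The orbit has empty interior, so a derivative within it is pinned down only along curves
  inside it. Composition with the curve of \<open>tangent_curve\<close> reduces the claim to
  uniqueness of a derivative in one real variable.\<close>

lemma derivative_unique_on_tangent:
  assumes X: "X \<in> nil_orbit" and Y: "Y \<in> tangent X"
    and D: "(f has_derivative D) (at X within nil_orbit)" "(f has_derivative D') (at X within nil_orbit)"
  shows "D Y = D' Y"
proof -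
  obtain Z e where e: "e > 0" "\<And>t. \<bar>t\<bar> < e \<Longrightarrow> X + t *\<^sub>R Y + t\<^sup>2 *\<^sub>R Z \<in> nil_orbit"
    using tangent_curve[OF X Y] by metis
  define \<gamma> where "\<gamma> t = X + t *\<^sub>R Y + t\<^sup>2 *\<^sub>R Z" for t :: real
  have \<gamma>: "(\<gamma> has_derivative (\<lambda>t. t *\<^sub>R Y)) (at 0 within ball 0 e)"
    unfolding \<gamma>_def by (auto intro!: derivative_eq_intros)
  have sub: "\<gamma> ` ball 0 e \<subseteq> nil_orbit"
    using e(2) by (auto simp: \<gamma>_def)
  have "\<gamma> 0 = X" by (simp add: \<gamma>_def)
  have "((f \<circ> \<gamma>) has_derivative (E \<circ> (\<lambda>t. t *\<^sub>R Y))) (at 0)"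
    if "(f has_derivative E) (at X within nil_orbit)" for E
    using diff_chain_within[OF \<gamma>, of f E] has_derivative_subset[OF that sub] e(1)
    by (simp add: \<open>\<gamma> 0 = X\<close> at_within_open[of 0 "ball 0 e"])
  from has_derivative_unique[OF this[OF D(1)] this[OF D(2)]]
  have "(D \<circ> (\<lambda>t. t *\<^sub>R Y)) 1 = (D' \<circ> (\<lambda>t. t *\<^sub>R Y)) 1" by simp
  then show ?thesis by simp
qed

lemma dir_deriv_eq:
  assumes "X \<in> nil_orbit" "Y \<in> tangent X" "(f has_derivative D) (at X within nil_orbit)"
  shows "dir_deriv f X Y = D Y"
  unfolding dir_deriv_def
  using assms frechet_derivative_works[of f "at X within nil_orbit"]
  by (intro derivative_unique_on_tangent[of X Y f]) (auto simp: differentiable_def)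

lemma dir_deriv_eq_local:
  assumes "X \<in> nil_orbit" "Y \<in> tangent X" "(g has_derivative D) (at X within nil_orbit)"
    and "open S" "X \<in> S" "\<And>P. P \<in> nil_orbit \<Longrightarrow> P \<in> S \<Longrightarrow> f P = g P"
  shows "dir_deriv f X Y = D Y"
proof -
  obtain e where "e > 0" "ball X e \<subseteq> S"
    using assms(4,5) openE by blast
  then have "(f has_derivative D) (at X within nil_orbit)"
    using assms(6) by (intro has_derivative_transform_within[OF assms(3) _ assms(1)])
      (auto simp: dist_commute subset_iff)
  then show ?thesis by (rule dir_deriv_eq[OF assms(1,2)])
qed

lemma dir_deriv_cong:
  assumes "X \<in> nil_orbit" "\<And>P. P \<in> nil_orbit \<Longrightarrow> f P = g P"
  shows "dir_deriv f X = dir_deriv g X"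
proof -
  have "(f has_derivative D) (at X within nil_orbit) \<longleftrightarrow> (g has_derivative D) (at X within nil_orbit)" for D
    using assms by (intro iffI; elim has_derivative_transform[rotated 2]) auto
  then show ?thesis by (simp add: dir_deriv_def frechet_derivative_def fun_eq_iff)
qed

lemma vector_field_has_derivative:
  assumes "vector_field U" "X \<in> nil_orbit"
  obtains U' where "(U has_derivative U') (at X within nil_orbit)"
  using assms smooth_map_on_differentiable unfolding vector_field_def differentiable_def by blast

lemma vector_field_tangent: "vector_field U \<Longrightarrow> X \<in> nil_orbit \<Longrightarrow> U X \<in> tangent X"
  by (simp add: vector_field_def)

lemma lie_bracket_eq:
  assumes "X \<in> nil_orbit" "vector_field U" "vector_field V"
    and "(U has_derivative U') (at X within nil_orbit)" "(V has_derivative V') (at X within nil_orbit)"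
  shows "lie_bracket U V X = V' (U X) - U' (V X)"
  using assms by (simp add: lie_bracket_def dir_deriv_eq vector_field_tangent)

lemma bounded_linear_trace: "bounded_linear (trace :: mat2 \<Rightarrow> complex)"
  unfolding linear_conv_bounded_linear[symmetric]
  by (auto intro!: linearI simp: trace_2 algebra_simps)

lemma bounded_bibounded_linear_trace_mult: "bounded_bilinear (\<lambda>(A :: mat2) B. trace (A ** B))"
  unfolding bilinear_conv_bounded_bilinear[symmetric] bilinear_def
  by (auto intro!: linearI simp: mat2_simps algebra_simps)

text \<open>Differentiating the equations \<open>trace (V P) = 0\<close> and \<open>trace (P ** V P) = 0\<close> along \<open>U\<close>
  gives the tangency; the second-order terms \<open>trace (U X ** V X)\<close> cancel.\<close>

lemma lie_bracket_tangent:
  assumes X: "X \<in> nil_orbit" and UV: "vector_field U" "vector_field V"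
  shows "lie_bracket U V X \<in> tangent X"
proof -
  obtain U' where U': "(U has_derivative U') (at X within nil_orbit)"
    by (rule vector_field_has_derivative[OF UV(1) X])
  obtain V' where V': "(V has_derivative V') (at X within nil_orbit)"
    by (rule vector_field_has_derivative[OF UV(2) X])
  have *: "trace (W' Y) = 0 \<and> trace (X ** W' Y) + trace (Y ** W X) = 0"
    if W: "vector_field W" and W': "(W has_derivative W') (at X within nil_orbit)"
      and Y: "Y \<in> tangent X" for W W' Y
  proof -
    have t: "trace (W P) = 0" "trace (P ** W P) = 0" if "P \<in> nil_orbit" for P
      using W that tangent_trace_iff[OF that] by (auto simp: vector_field_def)
    have "trace (W' Y) = dir_deriv (\<lambda>P. trace (W P)) X Y"
      by (rule dir_deriv_eq[OF X Y bounded_linear.has_derivative[OF bounded_linear_trace W'], symmetric])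
    also have "\<dots> = dir_deriv (\<lambda>P. 0) X Y"
      by (simp add: dir_deriv_cong[OF X t(1)])
    also have "\<dots> = 0"
      by (rule dir_deriv_eq[OF X Y has_derivative_const])
    finally have 1: "trace (W' Y) = 0" .
    have "trace (X ** W' Y) + trace (Y ** W X) = dir_deriv (\<lambda>P. trace (P ** W P)) X Y"
      by (rule dir_deriv_eq[OF X Y bounded_bilinear.FDERIV[OF bounded_bibounded_linear_trace_mult
          has_derivative_ident W'], symmetric])
    also have "\<dots> = dir_deriv (\<lambda>P. 0) X Y"
      by (simp add: dir_deriv_cong[OF X t(2)])
    also have "\<dots> = 0"
      by (rule dir_deriv_eq[OF X Y has_derivative_const])
    finally show ?thesis using 1 by simp
  qed
  note 1 = *[OF UV(1) U' vector_field_tangent[OF UV(2) X]]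
    and 2 = *[OF UV(2) V' vector_field_tangent[OF UV(1) X]]
  have "trace (U X ** V X) = trace (V X ** U X)" by (rule trace_mul_sym)
  with 1 2 have "trace (V' (U X) - U' (V X)) = 0 \<and> trace (X ** (V' (U X) - U' (V X))) = 0"
    by (simp add: bounded_bilinear.diff_right[OF bounded_bibounded_linear_trace_mult]
        linear_diff[OF bounded_linear.linear[OF bounded_linear_trace]] add_eq_0_iff)
  then show ?thesis
    by (simp add: lie_bracket_eq[OF X UV U' V'] tangent_trace_iff[OF X])
qed

text \<open>The product rule splits each derivative into a coefficient part \<open>\<eta>'\<close>
  and parts that differentiate the fields. The latter cancel against the Lie bracket terms by
  antisymmetry, and the cyclic sum of \<open>\<eta>'\<close> remains, the coordinate formula for the
  exterior derivative. The formula \<open>\<eta>\<close> has to agree with \<open>\<omega>\<close>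
  only near \<open>X\<close> and only on tangent vectors.\<close>

lemma ext_deriv2_eq_0:
  assumes X: "X \<in> nil_orbit" and vf: "vector_field U" "vector_field V" "vector_field W"
    and S: "open S" "X \<in> S"
    and eq: "\<And>P Y Z. P \<in> nil_orbit \<Longrightarrow> P \<in> S \<Longrightarrow> Y \<in> tangent P \<Longrightarrow> Z \<in> tangent P \<Longrightarrow> \<omega> P Y Z = \<eta> P Y Z"
    and der: "\<And>A B A' B'. (A has_derivative A') (at X within nil_orbit) \<Longrightarrow>
      (B has_derivative B') (at X within nil_orbit) \<Longrightarrow>
      ((\<lambda>P. \<eta> P (A P) (B P)) has_derivative
        (\<lambda>H. \<eta>' H (A X) (B X) + \<eta> X (A' H) (B X) + \<eta> X (A X) (B' H))) (at X within nil_orbit)"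
    and anti: "\<And>Y Z. \<eta> X Y Z = - \<eta> X Z Y"
    and diff: "\<And>Y Y' Z. \<eta> X (Y - Y') Z = \<eta> X Y Z - \<eta> X Y' Z"
    and cyc: "\<And>Y Z Z'. Y \<in> tangent X \<Longrightarrow> Z \<in> tangent X \<Longrightarrow> Z' \<in> tangent X \<Longrightarrow>
      \<eta>' Y Z Z' - \<eta>' Z Y Z' + \<eta>' Z' Y Z = 0"
  shows "ext_deriv2 \<omega> U V W X = 0"
proof -
  obtain U' where U': "(U has_derivative U') (at X within nil_orbit)"
    by (rule vector_field_has_derivative[OF vf(1) X])
  obtain V' where V': "(V has_derivative V') (at X within nil_orbit)"
    by (rule vector_field_has_derivative[OF vf(2) X])
  obtain W' where W': "(W has_derivative W') (at X within nil_orbit)"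
    by (rule vector_field_has_derivative[OF vf(3) X])
  note t = vf[THEN vector_field_tangent, OF X]
  have d: "dir_deriv (\<lambda>P. \<omega> P (A P) (B P)) X Y = \<eta>' Y (A X) (B X) + \<eta> X (A' Y) (B X) + \<eta> X (A X) (B' Y)"
    if "vector_field A" "vector_field B" "(A has_derivative A') (at X within nil_orbit)"
      "(B has_derivative B') (at X within nil_orbit)" "Y \<in> tangent X" for A B A' B' Y
    using that eq by (intro dir_deriv_eq_local[OF X that(5) der[OF that(3,4)] S]) (auto simp: vector_field_def)
  have b: "\<omega> X (lie_bracket A B X) (C X) = \<eta> X (B' (A X)) (C X) - \<eta> X (A' (B X)) (C X)"
    if "vector_field A" "vector_field B" "(A has_derivative A') (at X within nil_orbit)"
      "(B has_derivative B') (at X within nil_orbit)" "vector_field C" for A B C A' B'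
    using eq[OF X S(2) lie_bracket_tangent[OF X that(1,2)] vector_field_tangent[OF that(5) X]]
      lie_bracket_eq[OF X that(1-4)] diff by simp
  show ?thesis
    unfolding ext_deriv2_def
    using cyc[OF t]
      anti[of "V X" "W' (U X)"] anti[of "U X" "W' (V X)"] anti[of "U X" "V' (W X)"]
    by (simp add: d[OF vf(2,3) V' W' t(1)] d[OF vf(1,3) U' W' t(2)] d[OF vf(1,2) U' V' t(3)]
        b[OF vf(1,2) U' V' vf(3)] b[OF vf(1,3) U' W' vf(2)] b[OF vf(2,3) V' W' vf(1)])
qed

text \<open>The fundamental field of the adjoint action, \<open>P \<mapsto> [A, P]\<close>, is
  linear and defined on the whole orbit, so no cutoff function enters.\<close>

lemma vector_field_through:
  assumes "X \<in> nil_orbit" "Y \<in> tangent X"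
  obtains W where "vector_field W" "W X = Y"
proof -
  obtain A where A: "A \<in> sl2" "Y = bracket A X"
    using assms(2) by (auto simp: tangent_def \<xi>_def)
  have "vector_field (bracket A)"
    using A(1) bounded_bilinear.smooth_map_on[OF bounded_bilinear_bracket
        smooth_map_on_const smooth_map_on_ident, of nil_orbit A]
    by (auto simp: vector_field_def intro: tangentI)
  with A that show thesis by blast
qed

text \<open>The complex vector fields annihilated by the closed form \<open>\<omega>\<^sub>1 + \<i> \<omega>\<^sub>2\<close> are those of the form
  \<open>U + \<i> J U\<close>, and closedness makes this distribution involutive.\<close>

lemma nijenhuis_eq_0:
  assumes X: "X \<in> nil_orbit" and vf: "vector_field U" "vector_field V"
    and Jvf: "\<And>U. vector_field U \<Longrightarrow> vector_field (\<lambda>P. J P (U P))"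
    and JJ: "\<And>P Y. P \<in> nil_orbit \<Longrightarrow> Y \<in> tangent P \<Longrightarrow> J P Y \<in> tangent P \<and> J P (J P Y) = - Y"
    and rel: "\<And>P Y Z. P \<in> nil_orbit \<Longrightarrow> Y \<in> tangent P \<Longrightarrow> Z \<in> tangent P \<Longrightarrow> \<omega>\<^sub>2 P (J P Y) Z = \<omega>\<^sub>1 P Y Z"
    and anti: "\<And>P Y Z. P \<in> nil_orbit \<Longrightarrow> Y \<in> tangent P \<Longrightarrow> Z \<in> tangent P \<Longrightarrow>
      \<omega>\<^sub>1 P Y Z = - \<omega>\<^sub>1 P Z Y \<and> \<omega>\<^sub>2 P Y Z = - \<omega>\<^sub>2 P Z Y"
    and lin: "\<And>P Y Y' Z a b. P \<in> nil_orbit \<Longrightarrow> Y \<in> tangent P \<Longrightarrow> Y' \<in> tangent P \<Longrightarrow> Z \<in> tangent P \<Longrightarrow>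
      \<omega>\<^sub>1 P (a *\<^sub>R Y + b *\<^sub>R Y') Z = a * \<omega>\<^sub>1 P Y Z + b * \<omega>\<^sub>1 P Y' Z \<and>
      \<omega>\<^sub>2 P (a *\<^sub>R Y + b *\<^sub>R Y') Z = a * \<omega>\<^sub>2 P Y Z + b * \<omega>\<^sub>2 P Y' Z"
    and diff: "\<And>U V. vector_field U \<Longrightarrow> vector_field V \<Longrightarrow>
      (\<lambda>P. \<omega>\<^sub>1 P (U P) (V P)) differentiable (at X within nil_orbit) \<and>
      (\<lambda>P. \<omega>\<^sub>2 P (U P) (V P)) differentiable (at X within nil_orbit)"
    and closed: "closed_two_form \<omega>\<^sub>1" "closed_two_form \<omega>\<^sub>2"
    and nondeg: "\<And>Y. Y \<in> tangent X \<Longrightarrow> (\<And>Z. Z \<in> tangent X \<Longrightarrow> \<omega>\<^sub>1 X Y Z = 0) \<Longrightarrow> Y = 0"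
  shows "nijenhuis J U V X = 0"
proof -
  let ?JU = "\<lambda>P. J P (U P)" and ?JV = "\<lambda>P. J P (V P)"
  note J = vf[THEN Jvf]
  note lt = lie_bracket_tangent[OF X]
  note tan = vf[THEN vector_field_tangent]
  have r2: "\<omega>\<^sub>2 P Y (J P Z) = \<omega>\<^sub>1 P Y Z" if "P \<in> nil_orbit" "Y \<in> tangent P" "Z \<in> tangent P" for P Y Z
    using rel[OF that(1,3,2)] anti[OF that] anti[OF that(1,2), of "J P Z"] JJ[OF that(1,3)] by simp
  have neg: "\<omega>\<^sub>1 P (- Y) Z = - \<omega>\<^sub>1 P Y Z" "\<omega>\<^sub>2 P (- Y) Z = - \<omega>\<^sub>2 P Y Z"
    if "P \<in> nil_orbit" "Y \<in> tangent P" "Z \<in> tangent P" for P Y Z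
    using lin[OF that(1,2,2,3), of "- 1" 0] by simp_all
  have r3: "\<omega>\<^sub>1 P (J P Y) Z = - \<omega>\<^sub>2 P Y Z" if "P \<in> nil_orbit" "Y \<in> tangent P" "Z \<in> tangent P" for P Y Z
    using rel[OF that(1) _ that(3), of "J P Y"] JJ[OF that(1,2)] neg[OF that] by simp
  have r4: "\<omega>\<^sub>1 P Y (J P Z) = - \<omega>\<^sub>2 P Y Z" if "P \<in> nil_orbit" "Y \<in> tangent P" "Z \<in> tangent P" for P Y Z
    using r3[OF that(1,3,2)] anti[OF that] anti[OF that(1,2), of "J P Z"] JJ[OF that(1,3)] by simp
  have r5: "\<omega>\<^sub>1 P (J P Y) (J P Z) = - \<omega>\<^sub>1 P Y Z" if "P \<in> nil_orbit" "Y \<in> tangent P" "Z \<in> tangent P" for P Y Z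
    using r3[OF that(1,2), of "J P Z"] r2[OF that] JJ[OF that(1,3)] by simp
  define N where "N = nijenhuis J U V X"
  have N: "N \<in> tangent X"
    unfolding N_def nijenhuis_def using JJ[OF X] by (intro tangent_diff lt vf J) (auto intro!: lt vf J)
  have "\<omega>\<^sub>1 X N Z = 0" if Z: "Z \<in> tangent X" for Z
  proof -
    obtain W where W: "vector_field W" "W X = Z"
      by (rule vector_field_through[OF X Z])
    note tanW = vector_field_tangent[OF W(1)]
    have minus: "dir_deriv (\<lambda>P. - f P) X Y = - dir_deriv f X Y"
      if "f differentiable (at X within nil_orbit)" "Y \<in> tangent X" for f :: "mat2 \<Rightarrow> real" and Y
    proof -
      obtain D where D: "(f has_derivative D) (at X within nil_orbit)"
        using \<open>f differentiable (at X within nil_orbit)\<close> by (auto simp: differentiable_def)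
      show ?thesis
        by (simp add: dir_deriv_eq[OF X that(2) has_derivative_minus[OF D]] dir_deriv_eq[OF X that(2) D])
    qed
    \<comment> \<open>Up to sign these four are the terms in the real part of
      \<open>d(\<omega>\<^sub>1 + \<i> \<omega>\<^sub>2)(U + \<i> J U, V + \<i> J V, W)\<close>.
      Both complex fields annihilate the form identically, so the derivative terms cancel
      (\<open>d1\<close> to \<open>d4\<close>), and of the bracket terms only
      \<open>\<omega>\<^sub>1(N, W)\<close> survives.\<close>
    have e: "ext_deriv2 \<omega>\<^sub>1 U V W X = 0" "ext_deriv2 \<omega>\<^sub>1 ?JU ?JV W X = 0"
      "ext_deriv2 \<omega>\<^sub>2 ?JU V W X = 0" "ext_deriv2 \<omega>\<^sub>2 U ?JV W X = 0"
      using closed vf J W(1) X unfolding closed_two_form_def by blast+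
    have d1: "dir_deriv (\<lambda>P. \<omega>\<^sub>1 P (?JV P) (W P)) X (J X (U X)) = - dir_deriv (\<lambda>P. \<omega>\<^sub>2 P (V P) (W P)) X (J X (U X))"
      and d2: "dir_deriv (\<lambda>P. \<omega>\<^sub>1 P (?JU P) (W P)) X (J X (V X)) = - dir_deriv (\<lambda>P. \<omega>\<^sub>2 P (U P) (W P)) X (J X (V X))"
      and d3: "dir_deriv (\<lambda>P. \<omega>\<^sub>1 P (?JU P) (?JV P)) X Z = - dir_deriv (\<lambda>P. \<omega>\<^sub>1 P (U P) (V P)) X Z"
      using JJ[OF X tan(1)[OF X]] JJ[OF X tan(2)[OF X]] Z diff[OF vf(1) W(1)] diff[OF vf(2) W(1)] diff[OF vf]
      by (simp_all add: r3 r5 tan tanW flip: minus cong: dir_deriv_cong[OF X])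
    have d4: "dir_deriv (\<lambda>P. \<omega>\<^sub>2 P (?JU P) (W P)) X = dir_deriv (\<lambda>P. \<omega>\<^sub>1 P (U P) (W P)) X"
      "dir_deriv (\<lambda>P. \<omega>\<^sub>2 P (?JV P) (W P)) X = dir_deriv (\<lambda>P. \<omega>\<^sub>1 P (V P) (W P)) X"
      "dir_deriv (\<lambda>P. \<omega>\<^sub>2 P (?JU P) (V P)) X = dir_deriv (\<lambda>P. \<omega>\<^sub>1 P (U P) (V P)) X"
      "dir_deriv (\<lambda>P. \<omega>\<^sub>2 P (U P) (?JV P)) X = dir_deriv (\<lambda>P. \<omega>\<^sub>1 P (U P) (V P)) X"
      by (rule dir_deriv_cong[OF X]; simp add: rel r2 tan tanW)+
    have b: "\<omega>\<^sub>1 X (lie_bracket ?JU W X) (J X (V X)) = - \<omega>\<^sub>2 X (lie_bracket ?JU W X) (V X)"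
      "\<omega>\<^sub>1 X (lie_bracket ?JV W X) (J X (U X)) = - \<omega>\<^sub>2 X (lie_bracket ?JV W X) (U X)"
      "\<omega>\<^sub>2 X (lie_bracket U W X) (J X (V X)) = \<omega>\<^sub>1 X (lie_bracket U W X) (V X)"
      "\<omega>\<^sub>2 X (lie_bracket V W X) (J X (U X)) = \<omega>\<^sub>1 X (lie_bracket V W X) (U X)"
      using X by (simp_all add: r2 r4 lt vf J W(1) tan)
    have n: "\<omega>\<^sub>1 X N Z = \<omega>\<^sub>1 X (lie_bracket ?JU ?JV X) Z - \<omega>\<^sub>1 X (J X (lie_bracket ?JU V X)) Z
        - \<omega>\<^sub>1 X (J X (lie_bracket U ?JV X)) Z - \<omega>\<^sub>1 X (lie_bracket U V X) Z"
    proof -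
      have m: "\<omega>\<^sub>1 X (A - B) Z = \<omega>\<^sub>1 X A Z - \<omega>\<^sub>1 X B Z" if "A \<in> tangent X" "B \<in> tangent X" for A B
        using lin[OF X that Z, of 1 "- 1"] by simp
      show ?thesis
        unfolding N_def nijenhuis_def using JJ[OF X] by (simp add: m tangent_diff lt vf J)
    qed
    show ?thesis
      using e unfolding ext_deriv2_def W(2)
      by (simp add: n d1 d2 d3 d4 b r3[OF X _ Z] lt vf J)
  qed
  then have "N = 0" by (rule nondeg[OF N])
  then show ?thesis by (simp add: N_def)
qed

subsection \<open>The family of metrics\<close>

text \<open>Here \<open>w = s f'(s)\<close>, where the condition on \<open>f\<close> reads \<open>w (s dw/ds) = 2 s\<close>. The parameter \<open>c = 0\<close> is the
  flat metric of \<open>\<complex>\<^sup>2 / \<plusminus>1\<close>, and \<open>c > 0\<close> is the Eguchi-Hanson metric away from its zero section.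
  Below \<open>eh_d1 = f'\<close> and \<open>eh_d2 = f''\<close>.\<close>

definition eh_w :: "real \<Rightarrow> real \<Rightarrow> real" where
  "eh_w c s = sqrt (4 * s + c)"

definition eh_d1 :: "real \<Rightarrow> real \<Rightarrow> real" where
  "eh_d1 c s = eh_w c s / s"

definition eh_d2 :: "real \<Rightarrow> real \<Rightarrow> real" where
  "eh_d2 c s = 2 / (s * eh_w c s) - eh_w c s / s\<^sup>2"

text \<open>An antiderivative of \<open>w / s\<close>: with \<open>s = (w\<^sup>2 - c) / 4\<close>
  as the substitution, the integrand becomes \<open>2 + 2 c / (w\<^sup>2 - c)\<close> in the
  variable \<open>w\<close>, and partial fractions give the logarithms.\<close>

definition eh_potential :: "real \<Rightarrow> mat2 \<Rightarrow> real" where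
  "eh_potential c X = 2 * eh_w c (X \<bullet> X)
     + sqrt c * (ln (eh_w c (X \<bullet> X) - sqrt c) - ln (eh_w c (X \<bullet> X) + sqrt c))"

text \<open>The form \<open>2 f' h(Y, Z) + 2 f'' h(Y, X) h(X, Z)\<close> is the complex Hessian of \<open>f(\<bar>X\<bar>\<^sup>2)\<close>, up to the factor 2.\<close>

definition eh_herm :: "real \<Rightarrow> mat2 \<Rightarrow> mat2 \<Rightarrow> mat2 \<Rightarrow> complex" where
  "eh_herm c X Y Z = of_real (2 * eh_d1 c (X \<bullet> X)) * herm Y Z
     + of_real (2 * eh_d2 c (X \<bullet> X)) * (herm Y X * herm X Z)"

definition eh_metric :: "real \<Rightarrow> mat2 \<Rightarrow> mat2 \<Rightarrow> mat2 \<Rightarrow> real" where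
  "eh_metric c X Y Z = Re (eh_herm c X Y Z)"

text \<open>The coefficients below are determined by \<open>eh_metric c X Y (eh_J c X Z) = Re \<omega>\<^sub>c(Y, Z)\<close>; on the
  frame \<open>X\<close>, \<open>D = frame2 X\<close> of the tangent space this becomes \<open>J X = D / w\<close> and \<open>J D = - w X\<close>.\<close>

definition eh_a :: "real \<Rightarrow> real \<Rightarrow> real" where
  "eh_a c s = eh_w c s / (2 * s)"

definition eh_b :: "real \<Rightarrow> real \<Rightarrow> real" where
  "eh_b c s = (1 / eh_w c s - eh_a c s) / s"

definition eh_J :: "real \<Rightarrow> mat2 \<Rightarrow> mat2 \<Rightarrow> mat2" where
  "eh_J c X Y = bracket X (adjoint_mat
     (of_real (eh_a c (X \<bullet> X)) *\<^sub>C Y + (of_real (eh_b c (X \<bullet> X)) * herm Y X) *\<^sub>C X))"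

definition eh_K :: "real \<Rightarrow> mat2 \<Rightarrow> mat2 \<Rightarrow> mat2" where
  "eh_K c X Y = \<i> *\<^sub>C eh_J c X Y"

section \<open>Calculus of the radial functions\<close>

lemma eh_w_pos: "c \<ge> 0 \<Longrightarrow> s > 0 \<Longrightarrow> eh_w c s > 0"
  by (simp add: eh_w_def)

lemma has_real_derivative_eh_w:
  assumes "c \<ge> 0" "s > 0"
  shows "(eh_w c has_real_derivative 2 / eh_w c s) (at s)"
  unfolding eh_w_def[abs_def] using assms
  by (auto intro!: derivative_eq_intros simp: field_simps)

lemma has_real_derivative_eh_d1:
  assumes "c \<ge> 0" "s > 0"
  shows "(eh_d1 c has_real_derivative eh_d2 c s) (at s)"
  unfolding eh_d1_def[abs_def] eh_d2_def using assms eh_w_pos[OF assms]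
  by (auto intro!: derivative_eq_intros has_real_derivative_eh_w simp: field_simps power2_eq_square)

text \<open>No formula for the third derivative is recorded: its terms cancel in the exterior
  derivative of the Kaehler form, whatever its value.\<close>

lemma has_real_derivative_eh_d2:
  assumes "c \<ge> 0" "s > 0"
  obtains d where "(eh_d2 c has_real_derivative d) (at s)"
proof -
  have "eh_d2 c field_differentiable (at s)"
    unfolding eh_d2_def[abs_def] eh_w_def[abs_def]
  proof -
    have "\<exists>d. ((\<lambda>s. 2 / (s * sqrt (4 * s + c)) - sqrt (4 * s + c) / s\<^sup>2) has_real_derivative d) (at s)"
      using assms by (auto intro!: exI derivative_eq_intros)
    then show "(\<lambda>s. 2 / (s * sqrt (4 * s + c)) - sqrt (4 * s + c) / s\<^sup>2) field_differentiable (at s)"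
      by (simp add: field_differentiable_def)
  qed
  with that show thesis by (auto simp: field_differentiable_def)
qed

lemma has_real_derivative_eh_potential:
  assumes "c \<ge> 0" "s > 0"
  shows "((\<lambda>s. 2 * eh_w c s + sqrt c * (ln (eh_w c s - sqrt c) - ln (eh_w c s + sqrt c)))
    has_real_derivative eh_d1 c s) (at s)"
proof -
  let ?w = "eh_w c s" and ?k = "sqrt c"
  have w: "?w > 0" "?w > ?k" "?k \<ge> 0" "?w * ?w = 4 * s + ?k * ?k"
    using assms by (simp_all add: eh_w_def)
  then have wk: "?w - ?k > 0" "?w + ?k > 0" by linarith+
  have "((\<lambda>s. 2 * eh_w c s + ?k * (ln (eh_w c s - ?k) - ln (eh_w c s + ?k)))
      has_real_derivative 2 * (2 / ?w) + ?k * (2 / ?w / (?w - ?k) - 2 / ?w / (?w + ?k))) (at s)"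
    using wk assms by (auto intro!: derivative_eq_intros has_real_derivative_eh_w simp: mult.commute)
  also have "2 / ?w / (?w - ?k) - 2 / ?w / (?w + ?k) = ?k / (?w * s)"
  proof -
    have "2 / ?w / (?w - ?k) - 2 / ?w / (?w + ?k) = 4 * ?k / (?w * ((?w - ?k) * (?w + ?k)))"
      using w(1) wk by (simp add: divide_simps)
    also have "(?w - ?k) * (?w + ?k) = 4 * s"
      using w(4) by (simp add: algebra_simps)
    finally show ?thesis by simp
  qed
  also have "2 * (2 / ?w) + ?k * (?k / (?w * s)) = (4 * s + ?k * ?k) / (?w * s)"
    using w(1) assms(2) by (simp add: divide_simps)
  also have "\<dots> = eh_d1 c s"
    unfolding w(4)[symmetric] using w(1) by (simp add: eh_d1_def)
  finally show ?thesis .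
qed

section \<open>Linear algebra in the frame at a point\<close>

context
  fixes c :: real and X :: mat2
  assumes c: "c \<ge> 0" and X: "X \<in> nil_orbit"
begin

lemma eh_pos: "X \<bullet> X > 0" "eh_w c (X \<bullet> X) > 0"
  using nil_orbit_inner_pos[OF X] eh_w_pos[OF c] by auto

lemma tangent_frameE:
  assumes "Y \<in> tangent X"
  obtains y1 y2 where "Y = y1 *\<^sub>C X + y2 *\<^sub>C frame2 X"
  using tangent_frame[OF X assms] by blast

text \<open>The frame is orthogonal, so the form is diagonal. The product of the two weights is
  \<open>16 s\<^sup>2\<close>, free of \<open>c\<close>; this is what lets the fixed form
  \<open>\<omega>\<^sub>c\<close> yield a \<open>J\<close> of square \<open>-1\<close> for each
  member of the family.\<close>

lemma eh_herm_frame: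
  "eh_herm c X (y1 *\<^sub>C X + y2 *\<^sub>C frame2 X) (z1 *\<^sub>C X + z2 *\<^sub>C frame2 X) =
    of_real (4 * (X \<bullet> X) / eh_w c (X \<bullet> X)) * (y1 * cnj z1)
    + of_real (4 * (X \<bullet> X) * eh_w c (X \<bullet> X)) * (y2 * cnj z2)"
proof -
  let ?N = "X \<bullet> X" and ?w = "eh_w c (X \<bullet> X)"
  have "2 * eh_d1 c ?N * ?N + 2 * eh_d2 c ?N * ?N\<^sup>2 = 4 * ?N / ?w" "2 * eh_d1 c ?N * (2 * ?N\<^sup>2) = 4 * ?N * ?w"
    using eh_pos by (simp_all add: eh_d1_def eh_d2_def field_simps power2_eq_square)
  then have e: "of_real (4 * ?N / ?w) = complex_of_real (2 * eh_d1 c ?N * ?N + 2 * eh_d2 c ?N * ?N\<^sup>2)"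
    "of_real (4 * ?N * ?w) = complex_of_real (2 * eh_d1 c ?N * (2 * ?N\<^sup>2))"
    by simp_all
  show ?thesis
    unfolding e
    by (simp add: eh_herm_def herm.add_left herm.add_right herm_cscale_left herm_cscale_right
        herm_frame[OF X] herm_self[of X] algebra_simps power2_eq_square)
qed

text \<open>The adjoint makes \<open>eh_J\<close> conjugate-linear, hence anticommuting with
  \<open>I\<close>. It carries \<open>X\<close> to a multiple of
  \<open>[X, adjoint_mat X] = frame2 X\<close>, and the self-adjoint \<open>frame2 X\<close> to a
  multiple of \<open>[X, frame2 X]\<close>, that is of \<open>X\<close>. Orthogonality kills the
  \<open>eh_b\<close> term on \<open>frame2 X\<close>, so \<open>eh_a\<close> is fixed by the second
  image and \<open>eh_b\<close> corrects the first.\<close>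

lemma eh_J_frame:
  "eh_J c X (y1 *\<^sub>C X + y2 *\<^sub>C frame2 X) =
    (of_real (- eh_w c (X \<bullet> X)) * cnj y2) *\<^sub>C X + (of_real (1 / eh_w c (X \<bullet> X)) * cnj y1) *\<^sub>C frame2 X"
proof -
  let ?N = "X \<bullet> X" and ?w = "eh_w c (X \<bullet> X)"
  let ?a = "eh_a c ?N" and ?b = "eh_b c ?N"
  have "?a + ?b * ?N = 1 / ?w" "?a * (- 2 * ?N) = - ?w"
    using eh_pos by (simp_all add: eh_a_def eh_b_def)
  then have e: "of_real (1 / ?w) = complex_of_real (?a + ?b * ?N)"
    "of_real (- ?w) = complex_of_real (?a * (- 2 * ?N))"
    by simp_all
  have f: "bracket X (adjoint_mat X) = frame2 X"
    by (simp add: frame2_def)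
  have "eh_J c X (y1 *\<^sub>C X + y2 *\<^sub>C frame2 X) =
    (of_real ?a * cnj y2 * of_real (- 2 * ?N)) *\<^sub>C X
     + (of_real ?a * cnj y1 + of_real ?b * (cnj y1 * of_real ?N)) *\<^sub>C frame2 X"
    unfolding eh_J_def
    by (simp add: adjoint_mat_add adjoint_cscale cscale.add_left cscale.add_right cscale_cscale
        bracket.add_right bracket_cscale_right herm.add_left herm_cscale_left
        herm_frame[OF X] herm_self[of X] f algebra_simps)
  also have "\<dots> = (of_real (- ?w) * cnj y2) *\<^sub>C X + (of_real (1 / ?w) * cnj y1) *\<^sub>C frame2 X"
    unfolding e by (simp add: algebra_simps)
  finally show ?thesis .
qed

lemma eh_J_tangent: "eh_J c X Y \<in> tangent X" if t: "Y \<in> tangent X"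
proof -
  obtain y1 y2 where Y: "Y = y1 *\<^sub>C X + y2 *\<^sub>C frame2 X"
    by (rule tangent_frameE[OF t])
  show ?thesis
    unfolding Y eh_J_frame
    by (intro tangent_add tangent_cscale self_mem_tangent frame2_mem_tangent X)
qed

lemma eh_J_eh_J: "eh_J c X (eh_J c X Y) = - Y" if t: "Y \<in> tangent X"
proof -
  obtain y1 y2 where Y: "Y = y1 *\<^sub>C X + y2 *\<^sub>C frame2 X"
    by (rule tangent_frameE[OF t])
  show ?thesis
    unfolding Y eh_J_frame using eh_pos by (simp add: cscale.minus_left)
qed

lemma eh_J_add: "eh_J c X (Y + Z) = eh_J c X Y + eh_J c X Z"
  by (simp add: eh_J_def adjoint_mat_add bracket.add_right cscale.add_right cscale.add_left
      herm.add_left algebra_simps)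

lemma eh_J_cscale: "eh_J c X (z *\<^sub>C Y) = cnj z *\<^sub>C eh_J c X Y"
  by (simp add: eh_J_def adjoint_mat_add bracket.add_right cscale.add_right cscale.add_left
      herm_cscale_left adjoint_cscale bracket_cscale_right cscale_cscale cnj_herm algebra_simps)

lemma eh_herm_add_left: "eh_herm c X (Y + Y') Z = eh_herm c X Y Z + eh_herm c X Y' Z"
  by (simp add: eh_herm_def herm.add_left algebra_simps)

lemma eh_herm_cscale_left: "eh_herm c X (z *\<^sub>C Y) Z = z * eh_herm c X Y Z"
  by (simp add: eh_herm_def herm_cscale_left algebra_simps)

lemma eh_herm_cscale_right: "eh_herm c X Y (z *\<^sub>C Z) = cnj z * eh_herm c X Y Z"
  by (simp add: eh_herm_def herm_cscale_right algebra_simps)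

lemma cnj_eh_herm: "cnj (eh_herm c X Y Z) = eh_herm c X Z Y"
  by (simp add: eh_herm_def cnj_herm)

lemma eh_herm_eh_J:
  assumes "Y \<in> tangent X" "Z \<in> tangent X"
  shows "eh_herm c X (eh_J c X Y) (eh_J c X Z) = cnj (eh_herm c X Y Z)"
proof -
  obtain y1 y2 where Y: "Y = y1 *\<^sub>C X + y2 *\<^sub>C frame2 X"
    by (rule tangent_frameE[OF assms(1)])
  obtain z1 z2 where Z: "Z = z1 *\<^sub>C X + z2 *\<^sub>C frame2 X"
    by (rule tangent_frameE[OF assms(2)])
  show ?thesis
    unfolding Y Z eh_J_frame eh_herm_frame using eh_pos by simp
qed

lemma eh_herm_eh_J_frame:
  "eh_herm c X (y1 *\<^sub>C X + y2 *\<^sub>C frame2 X) (eh_J c X (z1 *\<^sub>C X + z2 *\<^sub>C frame2 X)) =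
    of_real (- 4 * (X \<bullet> X)) * (y1 * z2 - y2 * z1)"
  unfolding eh_J_frame eh_herm_frame using eh_pos by (simp add: algebra_simps)

lemma eh_metric_pos:
  assumes "Y \<in> tangent X" "Y \<noteq> 0"
  shows "eh_metric c X Y Y > 0"
proof -
  obtain y1 y2 where Y: "Y = y1 *\<^sub>C X + y2 *\<^sub>C frame2 X"
    by (rule tangent_frameE[OF assms(1)])
  have "y1 \<noteq> 0 \<or> y2 \<noteq> 0"
    using assms(2) by (auto simp: Y cscale.zero_left)
  moreover have "eh_metric c X Y Y = 4 * (X \<bullet> X) / eh_w c (X \<bullet> X) * (cmod y1)\<^sup>2
      + 4 * (X \<bullet> X) * eh_w c (X \<bullet> X) * (cmod y2)\<^sup>2"
    by (simp add: Y eh_metric_def eh_herm_frame flip: complex_norm_square)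
  ultimately show ?thesis
    using eh_pos by (auto simp: add_pos_nonneg add_nonneg_pos)
qed

text \<open>By invariance of the trace form the left side is \<open>4 trace ([A, X] B)\<close>.
  Expanding \<open>[A, X]\<close> leaves the traces of \<open>B\<close> against the frame, and the
  same invariance turns these into the frame coefficients of \<open>[B, X]\<close>. Both sides
  become \<open>- 4 s (y1 z2 - y2 z1)\<close>.\<close>

lemma inner_sl2_eh_J:
  assumes A: "A \<in> sl2" and B: "B \<in> sl2"
  shows "inner_sl2 X (bracket A B) = eh_herm c X (bracket A X) (eh_J c X (bracket B X))"
proof -
  obtain y1 y2 where Y: "bracket A X = y1 *\<^sub>C X + y2 *\<^sub>C frame2 X"
    by (rule tangent_frameE[OF tangentI[OF A]])
  obtain z1 z2 where Z: "bracket B X = z1 *\<^sub>C X + z2 *\<^sub>C frame2 X"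
    by (rule tangent_frameE[OF tangentI[OF B]])
  have tr: "trace (bracket B X ** W) = trace (B ** bracket X W)" for W
    by (simp add: mat2_simps algebra_simps)
  have "of_real (X \<bullet> X) * z1 = herm (bracket B X) X"
    by (simp add: Z herm.add_left herm_cscale_left herm_frame[OF X] herm_self)
  also have "\<dots> = trace (B ** frame2 X)"
    by (simp add: herm_def tr frame2_def)
  finally have t1: "trace (frame2 X ** B) = of_real (X \<bullet> X) * z1"
    unfolding trace_mul_sym[of "frame2 X" B] by (rule sym)
  have "of_real (2 * (X \<bullet> X)\<^sup>2) * z2 = herm (bracket B X) (frame2 X)"
    by (simp add: Z herm.add_left herm_cscale_left herm_frame[OF X])
  also have "\<dots> = of_real (- 2 * (X \<bullet> X)) * trace (X ** B)"
  proof -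
    have "trace (B ** bracket X (frame2 X)) = of_real (- 2 * (X \<bullet> X)) * trace (X ** B)"
      unfolding herm_frame(4)[OF X] by (simp add: trace_2 mat2_mult_nth cscale_nth algebra_simps)
    then show ?thesis
      unfolding herm_def herm_frame(5)[OF X] tr .
  qed
  finally have "of_real (X \<bullet> X) * (trace (X ** B) + of_real (X \<bullet> X) * z2) = 0"
    by (simp add: power2_eq_square algebra_simps)
  then have t2: "trace (X ** B) = - (of_real (X \<bullet> X) * z2)"
    using eh_pos(1) by (simp add: eq_neg_iff_add_eq_0)
  have "inner_sl2 X (bracket A B) = - 4 * trace (X ** bracket A B)"
    by (rule inner_sl2_trace[OF nil_orbit_mem_sl2[OF X] bracket_mem_sl2])
  also have "\<dots> = 4 * trace (bracket A X ** B)"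
    by (simp add: mat2_simps algebra_simps)
  also have "\<dots> = 4 * (y1 * trace (X ** B) + y2 * trace (frame2 X ** B))"
    by (simp add: Y mat2_simps algebra_simps)
  finally show ?thesis
    unfolding Y Z eh_herm_eh_J_frame t1 t2 by (simp add: algebra_simps)
qed

text \<open>An alternating complex bilinear form on a plane is determined by its value on one frame,
  so the factor comes from comparing the 2 by 2 minors of \<open>X\<close> and
  \<open>frame2 X\<close> with the value \<open>- 4 s\<close>.\<close>

lemma eh_herm_eh_J_charts:
  assumes "Y \<in> tangent X" "Z \<in> tangent X"
  shows "X$1$2 \<noteq> 0 \<Longrightarrow>
      eh_herm c X Y (eh_J c X Z) = 4 * (Y$1$1 * Z$1$2 - Y$1$2 * Z$1$1) * inverse (X$1$2)"
    and "X$2$1 \<noteq> 0 \<Longrightarrow>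
      eh_herm c X Y (eh_J c X Z) = - 4 * (Y$1$1 * Z$2$1 - Y$2$1 * Z$1$1) * inverse (X$2$1)"
proof -
  obtain y1 y2 where Y: "Y = y1 *\<^sub>C X + y2 *\<^sub>C frame2 X"
    by (rule tangent_frameE[OF assms(1)])
  obtain z1 z2 where Z: "Z = z1 *\<^sub>C X + z2 *\<^sub>C frame2 X"
    by (rule tangent_frameE[OF assms(2)])
  obtain a b where ab: "X$1$1 = a * b" "X$1$2 = - (a * a)" "X$2$1 = b * b" "X$2$2 = - (a * b)"
    using nil_orbit_spinor[OF X] by metis
  have N: "of_real (X \<bullet> X) = herm X X" by (simp add: herm_self)
  have "X$1$1 * frame2 X$1$2 - X$1$2 * frame2 X$1$1 = - of_real (X \<bullet> X) * X$1$2"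
    "X$1$1 * frame2 X$2$1 - X$2$1 * frame2 X$1$1 = of_real (X \<bullet> X) * X$2$1"
    unfolding N by (simp_all add: frame2_def mat2_simps ab algebra_simps)
  note k = this
  have "Y$1$1 * Z$1$2 - Y$1$2 * Z$1$1 = (y1 * z2 - y2 * z1) * (X$1$1 * frame2 X$1$2 - X$1$2 * frame2 X$1$1)"
    "Y$1$1 * Z$2$1 - Y$2$1 * Z$1$1 = (y1 * z2 - y2 * z1) * (X$1$1 * frame2 X$2$1 - X$2$1 * frame2 X$1$1)"
    by (simp_all add: Y Z cscale_nth algebra_simps)
  note l = this[unfolded k]
  show "eh_herm c X Y (eh_J c X Z) = 4 * (Y$1$1 * Z$1$2 - Y$1$2 * Z$1$1) * inverse (X$1$2)"
    if "X$1$2 \<noteq> 0"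
    unfolding l using that by (simp add: Y Z eh_herm_eh_J_frame)
  show "eh_herm c X Y (eh_J c X Z) = - 4 * (Y$1$1 * Z$2$1 - Y$2$1 * Z$1$1) * inverse (X$2$1)"
    if "X$2$1 \<noteq> 0"
    unfolding l using that by (simp add: Y Z eh_herm_eh_J_frame)
qed

end

subsection \<open>Closed forms and integrability\<close>

text \<open>The pointwise and smoothness conditions in \<open>kahler\<close> for \<open>J\<close>,
  short of integrability and closedness. Integrability of one structure is deduced from the forms of
  the other two, so this much is assumed of all three first.\<close>

definition almost_hermitian ::
  "(mat2 \<Rightarrow> mat2 \<Rightarrow> mat2 \<Rightarrow> real) \<Rightarrow> (mat2 \<Rightarrow> mat2 \<Rightarrow> mat2) \<Rightarrow> bool" where
  "almost_hermitian g J \<longleftrightarrow>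
     (\<forall>X\<in>nil_orbit.
        (\<forall>Y\<in>tangent X. J X Y \<in> tangent X \<and> J X (J X Y) = - Y) \<and>
        (\<forall>Y\<in>tangent X. \<forall>Z\<in>tangent X. \<forall>a b.
           J X (a *\<^sub>R Y + b *\<^sub>R Z) = a *\<^sub>R J X Y + b *\<^sub>R J X Z) \<and>
        (\<forall>Y\<in>tangent X. \<forall>Z\<in>tangent X. g X (J X Y) (J X Z) = g X Y Z)) \<and>
     (\<forall>U. vector_field U \<longrightarrow> vector_field (\<lambda>X. J X (U X)))"

lemma tangent_uminus: "Y \<in> tangent X \<Longrightarrow> - Y \<in> tangent X"
  using tangent_scaleR[of Y X "- 1"] by simp

lemma riemannian_metric_minus:
  assumes "riemannian_metric g" "X \<in> nil_orbit" "Y \<in> tangent X" "Z \<in> tangent X"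
  shows "g X (- Y) Z = - g X Y Z" "g X Z (- Y) = - g X Z Y"
proof -
  have "g X (- 1 *\<^sub>R Y + 0 *\<^sub>R Y) Z = - 1 * g X Y Z + 0 * g X Y Z"
    using assms unfolding riemannian_metric_def by blast
  then show 1: "g X (- Y) Z = - g X Y Z" by simp
  have sym: "g X A B = g X B A" if "A \<in> tangent X" "B \<in> tangent X" for A B
    using assms that unfolding riemannian_metric_def by blast
  show "g X Z (- Y) = - g X Z Y"
    using 1 sym[OF assms(4) tangent_uminus[OF assms(3)]] sym[OF assms(3,4)] by simp
qed

text \<open>From \<open>A C = - B\<close> and the isometry property,
  \<open>g(A Y, C Z) = g(Y, B Z)\<close>, which is the hypothesis \<open>rel\<close> of
  \<open>nijenhuis_eq_0\<close>. Nondegeneracy follows from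
  \<open>g(Y, B (B Y)) = - g(Y, Y)\<close>.\<close>

lemma complex_structure_of_closed_forms:
  assumes g: "riemannian_metric g"
    and A: "almost_hermitian g A" and B: "almost_hermitian g B" and C: "almost_hermitian g C"
    and AC: "\<And>X Y. X \<in> nil_orbit \<Longrightarrow> Y \<in> tangent X \<Longrightarrow> A X (C X Y) = - B X Y"
    and closed: "closed_two_form (kahler_form g B)" "closed_two_form (kahler_form g C)"
  shows "complex_structure A"
proof -
  have t: "J X Y \<in> tangent X" and sq: "J X (J X Y) = - Y"
    if "almost_hermitian g J" "X \<in> nil_orbit" "Y \<in> tangent X" for J X Y
    using that unfolding almost_hermitian_def by blast+
  have iso: "g X (J X Y) (J X Z) = g X Y Z"
    if "almost_hermitian g J" "X \<in> nil_orbit" "Y \<in> tangent X" "Z \<in> tangent X" for J X Y Z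
    using that unfolding almost_hermitian_def by blast
  have vf: "vector_field (\<lambda>X. J X (U X))" if "almost_hermitian g J" "vector_field U" for J U
    using that unfolding almost_hermitian_def by blast
  have sym: "g X Y Z = g X Z Y" if "X \<in> nil_orbit" "Y \<in> tangent X" "Z \<in> tangent X" for X Y Z
    using g that unfolding riemannian_metric_def by blast
  have lin: "g X (a *\<^sub>R Y + b *\<^sub>R Y') Z = a * g X Y Z + b * g X Y' Z"
    if "X \<in> nil_orbit" "Y \<in> tangent X" "Y' \<in> tangent X" "Z \<in> tangent X" for X Y Y' Z a b
    using g that unfolding riemannian_metric_def by blast
  have skew: "g X Y (J X Z) = - g X Z (J X Y)"
    if "almost_hermitian g J" "X \<in> nil_orbit" "Y \<in> tangent X" "Z \<in> tangent X" for J X Y Z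
    using iso[OF that(1-3) t[OF that(1,2,4)]] sq[OF that(1,2,4)] t[OF that(1-3)]
      riemannian_metric_minus[OF g that(2,4) t[OF that(1-3)]] sym[OF that(2,4) t[OF that(1-3)]] by simp
  have smooth: "(\<lambda>P. g P (U P) (J P (V P))) differentiable (at X within nil_orbit)"
    if "almost_hermitian g J" "vector_field U" "vector_field V" "X \<in> nil_orbit" for J U V X
    using g vf[OF that(1,3)] that(2,4) unfolding riemannian_metric_def
    by (blast intro: smooth_map_on_differentiable)
  have "nijenhuis A U V X = 0" if UV: "vector_field U" "vector_field V" and X: "X \<in> nil_orbit" for U V X
  proof (rule nijenhuis_eq_0[where \<omega>\<^sub>1 = "kahler_form g B" and \<omega>\<^sub>2 = "kahler_form g C", OF X UV vf[OF A]])
    fix P Y Z assume P: "P \<in> nil_orbit" "Y \<in> tangent P" "Z \<in> tangent P"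
    have "g P (A P Y) (C P Z) = g P (A P (A P Y)) (A P (C P Z))"
      by (rule iso[OF A P(1) t[OF A P(1,2)] t[OF C P(1,3)], symmetric])
    also have "\<dots> = g P (- Y) (- B P Z)"
      using P by (simp add: AC sq[OF A])
    also have "\<dots> = g P Y (B P Z)"
      using P by (simp add: riemannian_metric_minus[OF g] t[OF B] tangent_uminus)
    finally show "kahler_form g C P (A P Y) Z = kahler_form g B P Y Z"
      by (simp add: kahler_form_def)
    show "kahler_form g B P Y Z = - kahler_form g B P Z Y \<and> kahler_form g C P Y Z = - kahler_form g C P Z Y"
      using skew[OF B P] skew[OF C P] by (simp add: kahler_form_def)
  next
    fix Y assume Y: "Y \<in> tangent X" and zero: "\<And>Z. Z \<in> tangent X \<Longrightarrow> kahler_form g B X Y Z = 0"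
    have "g X Y Y = 0"
      using zero[OF t[OF B X Y]] sq[OF B X Y] riemannian_metric_minus[OF g X Y Y] by (simp add: kahler_form_def)
    moreover have "Y \<noteq> 0 \<Longrightarrow> g X Y Y > 0"
      using g X Y by (simp add: riemannian_metric_def)
    ultimately show "Y = 0" by linarith
  next
    fix P Y assume "P \<in> nil_orbit" "Y \<in> tangent P"
    then show "A P Y \<in> tangent P \<and> A P (A P Y) = - Y"
      by (simp add: t[OF A] sq[OF A])
  next
    fix P Y Y' Z and a b :: real
    assume P: "P \<in> nil_orbit" and Y: "Y \<in> tangent P" "Y' \<in> tangent P" and Z: "Z \<in> tangent P"
    show "kahler_form g B P (a *\<^sub>R Y + b *\<^sub>R Y') Z = a * kahler_form g B P Y Z + b * kahler_form g B P Y' Z \<and>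
      kahler_form g C P (a *\<^sub>R Y + b *\<^sub>R Y') Z = a * kahler_form g C P Y Z + b * kahler_form g C P Y' Z"
      unfolding kahler_form_def using lin[OF P Y t[OF B P Z]] lin[OF P Y t[OF C P Z]] by blast
  next
    fix U V assume "vector_field U" "vector_field V"
    then show "(\<lambda>P. kahler_form g B P (U P) (V P)) differentiable (at X within nil_orbit) \<and>
      (\<lambda>P. kahler_form g C P (U P) (V P)) differentiable (at X within nil_orbit)"
      unfolding kahler_form_def using smooth[OF B _ _ X] smooth[OF C _ _ X] by blast
  qed (assumption | fact closed)+
  then show ?thesis
    using A unfolding complex_structure_def almost_hermitian_def by simp
qed

lemma hyperkahler_of_closed_forms:
  assumes g: "riemannian_metric g"
    and I: "almost_hermitian g I" and J: "almost_hermitian g J" and K: "almost_hermitian g K"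
    and IJ: "\<And>X Y. X \<in> nil_orbit \<Longrightarrow> Y \<in> tangent X \<Longrightarrow> I X (J X Y) = K X Y \<and> J X (I X Y) = - K X Y"
    and closed: "closed_two_form (kahler_form g I)" "closed_two_form (kahler_form g J)"
      "closed_two_form (kahler_form g K)"
  shows "hyperkahler g I J K"
proof -
  have sq: "A X (A X Y) = - Y" and t: "A X Y \<in> tangent X"
    if "almost_hermitian g A" "X \<in> nil_orbit" "Y \<in> tangent X" for A X Y
    using that unfolding almost_hermitian_def by blast+
  \<comment> \<open>The quaternion products \<open>A C = - B\<close> for the three cyclic choices of
    \<open>(A, B, C)\<close> from \<open>I\<close>, \<open>J\<close>, \<open>K\<close>.\<close>
  have "I X (K X Y) = - J X Y" "K X (J X Y) = - I X Y" "J X (I X Y) = - K X Y"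
    if "X \<in> nil_orbit" "Y \<in> tangent X" for X Y
  proof -
    have "I X (I X (J X Y)) = - J X Y" by (rule sq[OF I that(1) t[OF J that]])
    then show "I X (K X Y) = - J X Y" using IJ[OF that] by simp
    have lin: "I X (- 1 *\<^sub>R Y + 0 *\<^sub>R Y) = - 1 *\<^sub>R I X Y + 0 *\<^sub>R I X Y"
      using I that unfolding almost_hermitian_def by blast
    have "K X (J X Y) = I X (J X (J X Y))"
      using IJ[OF that(1) t[OF J that]] by simp
    with lin show "K X (J X Y) = - I X Y" by (simp add: sq[OF J that])
    show "J X (I X Y) = - K X Y" using IJ[OF that] by simp
  qed
  then have "complex_structure I" "complex_structure J" "complex_structure K"
    using complex_structure_of_closed_forms[OF g I J K _ closed(2,3)]
      complex_structure_of_closed_forms[OF g J K I _ closed(3,1)]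
      complex_structure_of_closed_forms[OF g K I J _ closed(1,2)] by simp_all
  moreover have "\<forall>X\<in>nil_orbit. \<forall>Y\<in>tangent X. \<forall>Z\<in>tangent X. g X (A X Y) (A X Z) = g X Y Z"
    if "almost_hermitian g A" for A
    using that unfolding almost_hermitian_def by simp
  ultimately show ?thesis
    using g I J K IJ closed unfolding hyperkahler_def kahler_def by simp
qed

section \<open>Closedness of the three Kaehler forms\<close>

lemma bounded_linear_mat2_nth: "bounded_linear (\<lambda>A :: mat2. A $ i $ j)"
  by (intro bounded_linear_compose[OF bounded_linear_vec_nth bounded_linear_vec_nth])

text \<open>Near a point where the matrix entry \<open>(i, j)\<close> does not vanish the form below is a multiple of
  \<open>dx \<and> dy / y\<close>, with \<open>x\<close> and \<open>y\<close> the entries \<open>(1, 1)\<close> and \<open>(i, j)\<close>.\<close>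

lemma ext_deriv2_chart:
  assumes X: "X \<in> nil_orbit" and vf: "vector_field U" "vector_field V" "vector_field W"
    and L: "bounded_linear L" and nz: "X $ i $ j \<noteq> 0"
    and eq: "\<And>P Y Z. P \<in> nil_orbit \<Longrightarrow> P $ i $ j \<noteq> 0 \<Longrightarrow> Y \<in> tangent P \<Longrightarrow> Z \<in> tangent P \<Longrightarrow>
      \<omega> P Y Z = L (k * (Y$1$1 * Z$i$j - Y$i$j * Z$1$1) * inverse (P $ i $ j))"
  shows "ext_deriv2 \<omega> U V W X = 0"
proof (rule ext_deriv2_eq_0[OF X vf])
  let ?\<eta> = "\<lambda>P Y Z. L (k * (Y$1$1 * Z$i$j - Y$i$j * Z$1$1) * inverse (P $ i $ j))"
  let ?\<eta>' = "\<lambda>H Y Z. L (k * (Y$1$1 * Z$i$j - Y$i$j * Z$1$1)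
    * - (inverse (X $ i $ j) * H $ i $ j * inverse (X $ i $ j)))"
  note L_add = linear_add[OF bounded_linear.linear[OF L]] linear_diff[OF bounded_linear.linear[OF L]]
    linear_neg[OF bounded_linear.linear[OF L]] linear_0[OF bounded_linear.linear[OF L]]
  show "open {P :: mat2. P $ i $ j \<noteq> 0}"
    by (intro open_Collect_neq continuous_intros)
  show "X \<in> {P. P $ i $ j \<noteq> 0}" using nz by simp
  show "\<omega> P Y Z = ?\<eta> P Y Z"
    if "P \<in> nil_orbit" "P \<in> {P. P $ i $ j \<noteq> 0}" "Y \<in> tangent P" "Z \<in> tangent P" for P Y Z
    using eq that by simp
  show "((\<lambda>P. ?\<eta> P (A P) (B P)) has_derivative
      (\<lambda>H. ?\<eta>' H (A X) (B X) + ?\<eta> X (A' H) (B X) + ?\<eta> X (A X) (B' H))) (at X within nil_orbit)"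
    if "(A has_derivative A') (at X within nil_orbit)" "(B has_derivative B') (at X within nil_orbit)"
    for A B A' B'
    unfolding L_add[symmetric]
    by (rule bounded_linear.has_derivative[OF L])
      (auto intro!: derivative_eq_intros nz that(1)[THEN bounded_linear.has_derivative[OF bounded_linear_mat2_nth]]
        that(2)[THEN bounded_linear.has_derivative[OF bounded_linear_mat2_nth]]
        has_derivative_ident[THEN bounded_linear.has_derivative[OF bounded_linear_mat2_nth]]
        simp: algebra_simps)
  show "?\<eta> X Y Z = - ?\<eta> X Z Y" for Y Z
    unfolding L_add[symmetric] by (simp add: algebra_simps)
  show "?\<eta> X (Y - Y') Z = ?\<eta> X Y Z - ?\<eta> X Y' Z" for Y Y' Z
    unfolding L_add[symmetric] by (simp add: algebra_simps)
  \<comment> \<open>The coefficient depends on \<open>y\<close> alone, so its differential is a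
    multiple of \<open>dy\<close>, and \<open>dy \<and> dx \<and> dy = 0\<close>.\<close>
  show "?\<eta>' Y Z Z' - ?\<eta>' Z Y Z' + ?\<eta>' Z' Y Z = 0" for Y Z Z'
    unfolding L_add(1,2)[symmetric] by (simp add: algebra_simps L_add(4))
qed

lemma has_derivative_inner_self:
  "((\<lambda>P :: mat2. P \<bullet> P) has_derivative (\<lambda>H. 2 * (X \<bullet> H))) (at X within S)"
  by (auto intro!: derivative_eq_intros simp: inner_commute)

lemmas has_derivative_herm = bounded_bilinear.FDERIV[OF bounded_bilinear_herm]

text \<open>In terms of the potential this is the symmetry of third derivatives; it is checked here
  on the explicit coefficients, which depend on the point through \<open>s\<close> and through the
  two factors paired with \<open>X\<close>.\<close>

lemma ext_deriv2_eh_herm: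
  assumes c: "c \<ge> 0" and X: "X \<in> nil_orbit"
    and vf: "vector_field U" "vector_field V" "vector_field W"
    and eq: "\<And>P Y Z. P \<in> nil_orbit \<Longrightarrow> Y \<in> tangent P \<Longrightarrow> Z \<in> tangent P \<Longrightarrow>
      \<omega> P Y Z = Im (eh_herm c P Y Z)"
  shows "ext_deriv2 \<omega> U V W X = 0"
proof -
  let ?N = "X \<bullet> X"
  have N: "?N > 0" by (rule nil_orbit_inner_pos[OF X])
  obtain d3 where d3: "(eh_d2 c has_real_derivative d3) (at ?N)"
    by (rule has_real_derivative_eh_d2[OF c N])
  note D1 = DERIV_compose_FDERIV[OF has_real_derivative_eh_d1[OF c N] has_derivative_inner_self[of X nil_orbit]]
  note D2 = DERIV_compose_FDERIV[OF d3 has_derivative_inner_self[of X nil_orbit]]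
  let ?\<eta>' = "\<lambda>H Y Z. Im (of_real (2 * (2 * (X \<bullet> H) * eh_d2 c ?N)) * herm Y Z
    + of_real (2 * (2 * (X \<bullet> H) * d3)) * (herm Y X * herm X Z)
    + of_real (2 * eh_d2 c ?N) * (herm Y H * herm X Z + herm Y X * herm H Z))"
  show ?thesis
  proof (rule ext_deriv2_eq_0[OF X vf open_UNIV, where \<eta> = "\<lambda>P Y Z. Im (eh_herm c P Y Z)" and \<eta>' = ?\<eta>'])
    show "((\<lambda>P. Im (eh_herm c P (A P) (B P))) has_derivative
        (\<lambda>H. ?\<eta>' H (A X) (B X) + Im (eh_herm c X (A' H) (B X)) + Im (eh_herm c X (A X) (B' H))))
        (at X within nil_orbit)"
      if "(A has_derivative A') (at X within nil_orbit)" "(B has_derivative B') (at X within nil_orbit)"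
      for A B A' B'
      \<comment> \<open>The sum of imaginary parts is collected into a single \<open>Im\<close>, so
        that one bounded linear map is applied to a complex derivative.\<close>
      unfolding eh_herm_def plus_complex.sel(2)[symmetric]
      by (rule bounded_linear.has_derivative[OF bounded_linear_Im], rule has_derivative_eq_rhs,
          (rule has_derivative_add has_derivative_mult has_derivative_herm that has_derivative_ident
            has_derivative_const D1 D2 bounded_linear.has_derivative[OF bounded_linear_of_real])+)
        (simp add: fun_eq_iff algebra_simps)
    show "Im (eh_herm c X Y Z) = - Im (eh_herm c X Z Y)" for Y Z
      using arg_cong[OF cnj_eh_herm[OF c X, of Z Y], of Im] by simp
    show "Im (eh_herm c X (Y - Y') Z) = Im (eh_herm c X Y Z) - Im (eh_herm c X Y' Z)" for Y Y' Z
      by (simp add: eh_herm_def herm.diff_left algebra_simps)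
    show "?\<eta>' Y Z Z' - ?\<eta>' Z Y Z' + ?\<eta>' Z' Y Z = 0" for Y Z Z'
    proof -
      have i: "X \<bullet> H = Re (herm H X)" for H
        by (simp add: Re_herm inner_commute)
      have h: "herm X Y = cnj (herm Y X)" "herm X Z = cnj (herm Z X)" "herm X Z' = cnj (herm Z' X)"
        "herm Z Y = cnj (herm Y Z)" "herm Z' Y = cnj (herm Y Z')" "herm Z' Z = cnj (herm Z Z')"
        by (simp_all add: cnj_herm)
      \<comment> \<open>By conjugate symmetry six Hermitian products remain. They are treated as
        independent complex unknowns, with \<open>a\<close> and \<open>b\<close> for the second and
        third derivative of \<open>f\<close>, and the identity is polynomial in real and imaginary
        parts.\<close>
      have "Im (of_real (2 * (2 * Re y * a)) * r + of_real (2 * (2 * Re y * b)) * (z * cnj w)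
            + of_real (2 * a) * (cnj p * cnj w + z * q))
          - Im (of_real (2 * (2 * Re z * a)) * q + of_real (2 * (2 * Re z * b)) * (y * cnj w)
            + of_real (2 * a) * (p * cnj w + y * r))
          + Im (of_real (2 * (2 * Re w * a)) * p + of_real (2 * (2 * Re w * b)) * (y * cnj z)
            + of_real (2 * a) * (q * cnj z + y * cnj r)) = 0" for a b :: real and y z w p q r :: complex
        by (simp add: Im_complex_of_real Re_complex_of_real) algebra
      then show ?thesis
        unfolding i h .
    qed
  qed (use eq in auto)
qed

subsection \<open>The hyperkaehler structures\<close>

lemmas smooth_map_on_herm = bounded_bilinear.smooth_map_on[OF bounded_bilinear_herm]
lemmas smooth_map_on_cscale = bounded_bilinear.smooth_map_on[OF bounded_bilinear_cscale]
lemmas smooth_map_on_bracket = bounded_bilinear.smooth_map_on[OF bounded_bilinear_bracket]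
lemmas smooth_map_on_adjoint_mat = bounded_linear.smooth_map_on[OF bounded_linear_adjoint_mat]
lemmas smooth_map_on_Re = bounded_linear.smooth_map_on[OF bounded_linear_Re]
lemmas smooth_map_on_of_real = bounded_linear.smooth_map_on[OF bounded_linear_of_real]

context
  fixes M :: "'a::real_normed_vector set" and c :: "'a \<Rightarrow> real" and P :: "'a \<Rightarrow> mat2"
  assumes c: "smooth_map_on M c" "\<And>x. x \<in> M \<Longrightarrow> c x \<ge> 0"
    and P: "smooth_map_on M P" "\<And>x. x \<in> M \<Longrightarrow> P x \<in> nil_orbit"
begin

text \<open>Parameter and point are functions on an arbitrary domain, so that the same lemmas serve
  a fixed \<open>c\<close> on the orbit and the joint dependence on \<open>(c, X)\<close>. At
  \<open>c = 0\<close> the radicand is still positive because \<open>s > 0\<close>.\<close>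

lemma smooth_map_on_eh_w: "smooth_map_on M (\<lambda>x. eh_w (c x) (P x \<bullet> P x))"
  unfolding eh_w_def using c(2) nil_orbit_inner_pos[OF P(2)]
  by (intro smooth_map_on_sqrt smooth_map_on_add smooth_map_on_mult smooth_map_on_inner
      smooth_map_on_const c(1) P(1)) (simp add: add_pos_nonneg)

lemma eh_w_ne_0: "x \<in> M \<Longrightarrow> eh_w (c x) (P x \<bullet> P x) \<noteq> 0"
  using eh_w_pos[OF c(2) nil_orbit_inner_pos[OF P(2)]] by fastforce

lemma nil_orbit_ne_0: "x \<in> M \<Longrightarrow> P x \<noteq> 0"
  using P(2) by (simp add: nil_orbit_iff)

lemma smooth_map_on_eh_coefficients:
  "smooth_map_on M (\<lambda>x. eh_d1 (c x) (P x \<bullet> P x))"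
  "smooth_map_on M (\<lambda>x. eh_d2 (c x) (P x \<bullet> P x))"
  "smooth_map_on M (\<lambda>x. eh_a (c x) (P x \<bullet> P x))"
  "smooth_map_on M (\<lambda>x. eh_b (c x) (P x \<bullet> P x))"
  unfolding eh_d1_def eh_d2_def eh_a_def eh_b_def power2_eq_square
  by (intro smooth_map_on_divide smooth_map_on_diff smooth_map_on_mult smooth_map_on_inner
      smooth_map_on_const smooth_map_on_eh_w P(1); simp add: eh_w_ne_0 nil_orbit_ne_0)+

lemma smooth_map_on_eh_metric:
  "smooth_map_on M U \<Longrightarrow> smooth_map_on M V \<Longrightarrow> smooth_map_on M (\<lambda>x. eh_metric (c x) (P x) (U x) (V x))"
  unfolding eh_metric_def eh_herm_def
  by (intro smooth_map_on_Re smooth_map_on_add smooth_map_on_mult smooth_map_on_of_real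
      smooth_map_on_herm smooth_map_on_const smooth_map_on_eh_coefficients P(1))

lemma smooth_map_on_eh_J:
  "smooth_map_on M U \<Longrightarrow> smooth_map_on M (\<lambda>x. eh_J (c x) (P x) (U x))"
  unfolding eh_J_def
  by (intro smooth_map_on_bracket smooth_map_on_adjoint_mat smooth_map_on_add smooth_map_on_cscale
      smooth_map_on_mult smooth_map_on_of_real smooth_map_on_herm smooth_map_on_eh_coefficients P(1))

end

section \<open>The invariant potential\<close>

lemma smooth_map_on_eh_potential:
  assumes "c \<ge> 0"
  shows "smooth_map_on nil_orbit (eh_potential c)"
proof -
  have w: "smooth_map_on nil_orbit (\<lambda>X. eh_w c (X \<bullet> X))"
    using assms by (intro smooth_map_on_eh_w smooth_map_on_const smooth_map_on_ident)
  have "eh_w c (X \<bullet> X) > sqrt c" "eh_w c (X \<bullet> X) + sqrt c > 0" if "X \<in> nil_orbit" for X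
    using nil_orbit_inner_pos[OF that] assms by (simp_all add: eh_w_def add_pos_nonneg)
  then show ?thesis
    unfolding eh_potential_def[abs_def]
    by (intro smooth_map_on_add smooth_map_on_mult smooth_map_on_const smooth_map_on_diff smooth_map_on_ln w)
      auto
qed

text \<open>The potential sees \<open>X\<close> only through
  \<open>trace (X ** adjoint_mat X)\<close>, and cyclicity of the trace brings the factors of a
  unitary conjugation together to the identity.\<close>

lemma eh_potential_SU2_invariant: "SU2_invariant (eh_potential c)"
proof -
  have "(U ** X ** matrix_inv U) \<bullet> (U ** X ** matrix_inv U) = X \<bullet> X" if U: "U \<in> SU2" for U X
  proof -
    have 1: "adjoint_mat U ** U = mat 1"
      using U by (simp add: SU2_def adjoint_mat_def)
    then have 2: "U ** adjoint_mat U = mat 1"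
      by (simp add: matrix_left_right_inverse)
    have inv: "matrix_inv U = adjoint_mat U"
    proof -
      have "U ** matrix_inv U = mat 1"
        unfolding matrix_inv_def by (rule someI2[of _ "adjoint_mat U"]) (simp_all add: 1 2)
      then have "adjoint_mat U ** U ** matrix_inv U = adjoint_mat U"
        by (simp flip: matrix_mul_assoc)
      then show ?thesis by (simp add: 1)
    qed
    have adj: "adjoint_mat (A ** B) = adjoint_mat B ** adjoint_mat A" "adjoint_mat (adjoint_mat A) = A" for A B
      by (simp_all add: mat2_simps algebra_simps)
    let ?A = "U ** X ** adjoint_mat U"
    have "herm ?A ?A = trace (U ** (X ** (adjoint_mat U ** U) ** adjoint_mat X ** adjoint_mat U))"
      by (simp add: herm_def adj matrix_mul_assoc)
    also have "\<dots> = trace (X ** (adjoint_mat U ** U) ** adjoint_mat X ** adjoint_mat U ** U)"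
      by (rule trace_mul_sym)
    also have "\<dots> = trace (X ** (adjoint_mat U ** U) ** adjoint_mat X ** (adjoint_mat U ** U))"
      by (simp only: matrix_mul_assoc)
    also have "\<dots> = herm X X"
      by (simp add: 1 herm_def)
    finally show ?thesis
      by (simp add: inv flip: Re_herm)
  qed
  then show ?thesis by (simp add: SU2_invariant_def eh_potential_def)
qed

lemma dir_deriv_eh_potential:
  assumes c: "c \<ge> 0" and X: "X \<in> nil_orbit" and Y: "Y \<in> tangent X"
  shows "dir_deriv (eh_potential c) X Y = 2 * (X \<bullet> Y) * eh_d1 c (X \<bullet> X)"
  unfolding eh_potential_def[abs_def]
  by (rule dir_deriv_eq[OF X Y DERIV_compose_FDERIV[OF
        has_real_derivative_eh_potential[OF c nil_orbit_inner_pos[OF X]] has_derivative_inner_self]])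

text \<open>The one-form \<open>I d\<rho>\<close> is \<open>2 f' Im (herm Y P)\<close>. In its
  exterior derivative the derivatives of the fields cancel against the Lie bracket; differentiating
  \<open>P\<close> in the second slot gives the \<open>f'\<close> term of \<open>eh_herm\<close>,
  and differentiating \<open>f'\<close> gives the rank-one \<open>f''\<close> term.\<close>

lemma eh_potential_kahler_potential:
  assumes c: "c \<ge> 0"
  shows "kahler_potential (eh_metric c) I_nat (eh_potential c)"
  unfolding kahler_potential_def
proof (intro conjI smooth_map_on_eh_potential[OF c] allI impI ballI)
  fix U V X assume UV: "vector_field U" "vector_field V" and X: "X \<in> nil_orbit"
  let ?N = "X \<bullet> X" and ?\<theta> = "act_one_form I_nat (dir_deriv (eh_potential c))"
  have N: "?N > 0" by (rule nil_orbit_inner_pos[OF X])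
  have \<theta>: "?\<theta> P Y = 2 * (eh_d1 c (P \<bullet> P) * Im (herm Y P))" if "P \<in> nil_orbit" "Y \<in> tangent P" for P Y
  proof -
    have "P \<bullet> (\<i> *\<^sub>C Y) = Re (herm (\<i> *\<^sub>C Y) P)"
      by (simp add: Re_herm inner_commute)
    then have "P \<bullet> (\<i> *\<^sub>C Y) = - Im (herm Y P)"
      by (simp add: herm_cscale_left)
    then show ?thesis
      using dir_deriv_eh_potential[OF c that(1) tangent_cscale[OF that(2)], of \<i>]
      by (simp add: act_one_form_def I_nat_cscale)
  qed
  have d: "dir_deriv (\<lambda>P. ?\<theta> P (A P)) X Y =
      2 * (eh_d1 c ?N * Im (herm (A X) Y + herm (A' Y) X) + 2 * (X \<bullet> Y) * eh_d2 c ?N * Im (herm (A X) X))"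
    if A: "vector_field A" "(A has_derivative A') (at X within nil_orbit)" and Y: "Y \<in> tangent X" for A A' Y
  proof -
    have "dir_deriv (\<lambda>P. ?\<theta> P (A P)) X Y = dir_deriv (\<lambda>P. 2 * (eh_d1 c (P \<bullet> P) * Im (herm (A P) P))) X Y"
      by (simp add: dir_deriv_cong[OF X \<theta>] vector_field_tangent[OF A(1)])
    also have "\<dots> = 2 * (eh_d1 c ?N * Im (herm (A X) Y + herm (A' Y) X) + 2 * (X \<bullet> Y) * eh_d2 c ?N * Im (herm (A X) X))"
      by (intro dir_deriv_eq[OF X Y] has_derivative_mult_right has_derivative_mult
          DERIV_compose_FDERIV[OF has_real_derivative_eh_d1[OF c N] has_derivative_inner_self]
          bounded_linear.has_derivative[OF bounded_linear_Im] has_derivative_herm A(2) has_derivative_ident)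
    finally show ?thesis .
  qed
  obtain U' where U': "(U has_derivative U') (at X within nil_orbit)"
    by (rule vector_field_has_derivative[OF UV(1) X])
  obtain V' where V': "(V has_derivative V') (at X within nil_orbit)"
    by (rule vector_field_has_derivative[OF UV(2) X])
  note t = UV[THEN vector_field_tangent, OF X]
  have i: "X \<bullet> H = Re (herm H X)" for H
    by (simp add: Re_herm inner_commute)
  have h: "herm (V X) (U X) = cnj (herm (U X) (V X))" "herm X (V X) = cnj (herm (V X) X)"
    by (simp_all add: cnj_herm)
  have l: "?\<theta> X (lie_bracket U V X) =
      2 * (eh_d1 c ?N * (Im (herm (V' (U X)) X) - Im (herm (U' (V X)) X)))"
    using \<theta>[OF X lie_bracket_tangent[OF X UV]] by (simp add: lie_bracket_eq[OF X UV U' V'] herm.diff_left)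
  have "kahler_form (eh_metric c) I_nat X (U X) (V X) = Im (eh_herm c X (U X) (V X))"
    by (simp add: kahler_form_def eh_metric_def I_nat_cscale eh_herm_cscale_right[OF c X])
  also have "\<dots> = - (1/2) * ext_deriv1 ?\<theta> U V X"
    unfolding ext_deriv1_def d[OF UV(2) V' t(1)] d[OF UV(1) U' t(2)] l eh_herm_def i[of "U X"] i[of "V X"] h
    by (simp add: algebra_simps)
  finally show "kahler_form (eh_metric c) I_nat X (U X) (V X) = - (1/2) * ext_deriv1 ?\<theta> U V X" .
qed

section \<open>Assembly of the hyperkaehler structure\<close>

context
  fixes c :: real
  assumes c: "c \<ge> 0"
begin

lemma riemannian_metric_eh_metric: "riemannian_metric (eh_metric c)"
  unfolding riemannian_metric_def
proof (intro conjI ballI allI impI)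
  fix X Y Z assume X: "X \<in> nil_orbit"
  show "eh_metric c X Y Z = eh_metric c X Z Y"
    using arg_cong[OF cnj_eh_herm[OF c X, of Z Y], of Re] by (simp add: eh_metric_def)
  show "eh_metric c X (a *\<^sub>R Y + b *\<^sub>R Y') Z = a * eh_metric c X Y Z + b * eh_metric c X Y' Z" for Y' a b
    by (simp add: eh_metric_def eh_herm_add_left[OF c X] eh_herm_cscale_left[OF c X] flip: cscale_of_real)
next
  fix X Y assume "X \<in> nil_orbit" "Y \<in> tangent X" "Y \<noteq> 0"
  then show "eh_metric c X Y Y > 0" by (rule eh_metric_pos[OF c])
next
  fix U V assume "vector_field U" "vector_field V"
  then show "smooth_map_on nil_orbit (\<lambda>X. eh_metric c X (U X) (V X))"
    using c by (intro smooth_map_on_eh_metric smooth_map_on_const smooth_map_on_ident)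
      (auto simp: vector_field_def)
qed

lemma almost_hermitian_eh:
  "almost_hermitian (eh_metric c) I_nat"
  "almost_hermitian (eh_metric c) (eh_J c)"
  "almost_hermitian (eh_metric c) (eh_K c)"
proof -
  have J: "vector_field (\<lambda>X. eh_J c X (U X))" if "vector_field U" for U
    using that c eh_J_tangent[OF c] unfolding vector_field_def
    by (auto intro!: smooth_map_on_eh_J smooth_map_on_const smooth_map_on_ident)
  have I: "vector_field (\<lambda>X. \<i> *\<^sub>C U X)" if "vector_field U" for U
    using that unfolding vector_field_def
    by (auto intro!: smooth_map_on_cscale smooth_map_on_const tangent_cscale)
  have s: "(r *\<^sub>R Y) = of_real r *\<^sub>C Y" for r Y by (simp add: cscale_of_real)
  have n: "(- 1) *\<^sub>C Y = - Y" for Y by (simp add: mat2_simps)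
  show "almost_hermitian (eh_metric c) I_nat"
    unfolding almost_hermitian_def I_nat_cscale
    by (auto simp: I tangent_cscale cscale_cscale n s cscale.add_right mult.commute eh_metric_def
        eh_herm_cscale_left[OF c] eh_herm_cscale_right[OF c])
  show "almost_hermitian (eh_metric c) (eh_J c)"
    unfolding almost_hermitian_def
    by (auto simp: J eh_J_tangent[OF c] eh_J_eh_J[OF c] s eh_J_add[OF c] eh_J_cscale[OF c] eh_metric_def
        eh_herm_eh_J[OF c])
  show "almost_hermitian (eh_metric c) (eh_K c)"
    unfolding almost_hermitian_def eh_K_def
    by (auto simp: I J tangent_cscale cscale_cscale n s cscale.add_right mult.commute eh_metric_def
        eh_herm_cscale_left[OF c] eh_herm_cscale_right[OF c] eh_J_tangent[OF c] eh_J_eh_J[OF c]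
        eh_J_add[OF c] eh_J_cscale[OF c] eh_herm_eh_J[OF c])
qed

lemma kahler_form_eh:
  assumes "X \<in> nil_orbit"
  shows "kahler_form (eh_metric c) I_nat X Y Z = Im (eh_herm c X Y Z)"
    "kahler_form (eh_metric c) (eh_J c) X Y Z = Re (eh_herm c X Y (eh_J c X Z))"
    "kahler_form (eh_metric c) (eh_K c) X Y Z = Im (eh_herm c X Y (eh_J c X Z))"
  by (simp_all add: kahler_form_def eh_metric_def I_nat_cscale eh_K_def eh_herm_cscale_right[OF c assms])

text \<open>The map \<open>L\<close> stands for \<open>Re\<close> or \<open>Im\<close>, so both
  parts of \<open>\<omega>\<^sub>c\<close> are handled at once. The charts of the two off-diagonal
  entries cover the orbit, since a nilpotent matrix with both entries zero vanishes.\<close>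

lemma closed_two_form_eh_J:
  assumes L: "bounded_linear L"
    and eq: "\<And>X Y Z. X \<in> nil_orbit \<Longrightarrow> \<omega> X Y Z = L (eh_herm c X Y (eh_J c X Z))"
  shows "closed_two_form \<omega>"
  unfolding closed_two_form_def
proof (intro allI impI ballI)
  fix U V W X assume vf: "vector_field U" "vector_field V" "vector_field W" and X: "X \<in> nil_orbit"
  show "ext_deriv2 \<omega> U V W X = 0"
  proof (cases "X$1$2 = 0")
    case False
    show ?thesis
      by (rule ext_deriv2_chart[OF X vf L False, where k = 4])
        (simp only: eq eh_herm_eh_J_charts(1)[OF c] not_False_eq_True)
  next
    case True
    with X have "X$2$1 \<noteq> 0" by (auto simp: nil_orbit_iff mat2_eq_iff)
    then show ?thesis
      by (rule ext_deriv2_chart[OF X vf L, where k = "- 4"]) (simp only: eq eh_herm_eh_J_charts(2)[OF c] not_False_eq_True)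
  qed
qed

lemma hyperkahler_eh: "hyperkahler (eh_metric c) I_nat (eh_J c) (eh_K c)"
proof (rule hyperkahler_of_closed_forms[OF riemannian_metric_eh_metric almost_hermitian_eh])
  show "I_nat X (eh_J c X Y) = eh_K c X Y \<and> eh_J c X (I_nat X Y) = - eh_K c X Y" if "X \<in> nil_orbit" for X Y
    by (simp add: I_nat_cscale eh_K_def eh_J_cscale[OF c that] cscale.minus_left)
  show "closed_two_form (kahler_form (eh_metric c) I_nat)"
    unfolding closed_two_form_def
    using ext_deriv2_eh_herm[OF c] kahler_form_eh(1) by blast
  show "closed_two_form (kahler_form (eh_metric c) (eh_J c))"
    by (rule closed_two_form_eh_J[OF bounded_linear_Re kahler_form_eh(2)])
  show "closed_two_form (kahler_form (eh_metric c) (eh_K c))"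
    by (rule closed_two_form_eh_J[OF bounded_linear_Im kahler_form_eh(3)])
qed

lemma KKS_compatible_eh: "KKS_compatible (eh_metric c) (eh_J c) (eh_K c)"
  unfolding KKS_compatible_def \<xi>_def
  by (simp add: kahler_form_eh inner_sl2_eh_J[OF c] complex_eq[symmetric])

end

text \<open>The metric depends on \<open>c\<close> only through \<open>4 s + c\<close>, hence
  smoothly up to the end \<open>c = 0\<close>, where the \<open>sqrt c\<close> of the potential
  fails to be differentiable.\<close>

lemma one_parameter_family_eh: "one_parameter_family {0..} eh_metric"
  unfolding one_parameter_family_def
proof (intro conjI allI impI ballI)
  show "is_interval {0::real..}" by (rule is_interval_ci)
  show "interior {0::real..} \<noteq> {}" by simp
  show "smooth_map_on ({0..} \<times> nil_orbit) (\<lambda>(c, X). eh_metric c X (U X) (V X))"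
    if "vector_field U" "vector_field V" for U V
  proof -
    have snd: "smooth_map_on ({0::real..} \<times> nil_orbit) (\<lambda>p. W (snd p))" if "smooth_map_on nil_orbit W" for W :: "mat2 \<Rightarrow> mat2"
      by (rule smooth_map_on_compose_linear[OF bounded_linear_snd that]) auto
    have "smooth_map_on ({0..} \<times> nil_orbit) (\<lambda>p. eh_metric (fst p) (snd p) (U (snd p)) (V (snd p)))"
      using that
      by (intro smooth_map_on_eh_metric snd bounded_linear.smooth_map_on[OF bounded_linear_fst]
          bounded_linear.smooth_map_on[OF bounded_linear_snd] smooth_map_on_ident) (auto simp: vector_field_def)
    then show ?thesis by (simp add: case_prod_beta')
  qed
  fix c c' :: real assume c: "c \<in> {0..}" "c' \<in> {0..}" "c \<noteq> c'"
  \<comment> \<open>The length of the radial vector separates the members: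
    \<open>g(X, X) = 4 s / w\<close> and \<open>w\<close> is strictly increasing in
    \<open>c\<close>.\<close>
  define X :: mat2 where "X = vector [vector [0, 1], vector [0, 0]]"
  have X: "X \<in> nil_orbit"
    by (simp add: nil_orbit_iff mat2_eq_iff X_def vector_2)
  have "eh_metric b X X X = 4 * (X \<bullet> X) / eh_w b (X \<bullet> X)" if "b \<ge> 0" for b
    using eh_herm_frame[OF that X, of 1 0 1 0] by (simp add: eh_metric_def cscale.zero_left)
  moreover have "eh_w c (X \<bullet> X) \<noteq> eh_w c' (X \<bullet> X)"
    using c(3) by (simp add: eh_w_def)
  ultimately have "eh_metric c X X X \<noteq> eh_metric c' X X X"
    using c nil_orbit_inner_pos[OF X] eh_w_pos[of c "X \<bullet> X"] eh_w_pos[of c' "X \<bullet> X"]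
    by (simp add: frac_eq_eq)
  then show "\<exists>X\<in>nil_orbit. \<exists>Y\<in>tangent X. \<exists>Z\<in>tangent X. eh_metric c X Y Z \<noteq> eh_metric c' X Y Z"
    using X self_mem_tangent[OF X] by blast
qed

theorem proposition5p1:
  shows "\<exists>(T :: real set) (g :: real \<Rightarrow> mat2 \<Rightarrow> mat2 \<Rightarrow> mat2 \<Rightarrow> real).
    one_parameter_family T g \<and>
    (\<forall>c\<in>T.
      (\<exists>J K. hyperkahler (g c) I_nat J K \<and> KKS_compatible (g c) J K) \<and>
      (\<exists>\<rho>. SU2_invariant \<rho> \<and> kahler_potential (g c) I_nat \<rho>))"
proof (intro exI[of _ "{0..}"] exI[of _ eh_metric] conjI one_parameter_family_eh ballI)
  fix c :: real assume "c \<in> {0..}"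
  then have c: "c \<ge> 0" by simp
  show "\<exists>J K. hyperkahler (eh_metric c) I_nat J K \<and> KKS_compatible (eh_metric c) J K"
    using hyperkahler_eh[OF c] KKS_compatible_eh[OF c] by blast
  show "\<exists>\<rho>. SU2_invariant \<rho> \<and> kahler_potential (eh_metric c) I_nat \<rho>"
    using eh_potential_SU2_invariant eh_potential_kahler_potential[OF c] by blast
qed

end
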